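(* Let $s\ge 1$ be an integer and let $c_1,\dots,c_s\in[0,1]$ be $s$ different fixed interpolation nodes. Suppose that $f$ satisfies $\sum_{\alpha\le s}|f^{(\alpha)}(t)|\lesssim 1$ for all $t\in[t_0,t_0+T]$, and that the exact solution $u$ of the parabolic problem satisfies $\sup_{t_0\le t\le t_0+T}\|u(t)\|_{2}\lesssim 1$ and $\sup_{t_0\le t\le t_0+T}\|u_t(t)\|_{2}\lesssim 1$. Let $u_h$ be the solution of the semi-discrete problem and let $\{u_h^n\}$ be the numerical solution at the times $\tau_n$ produced by applying the EIFE-linear method with the nodes $c_1,\dots,c_s$ sequentially. Then $$\|u_h(\tau_n)-u_h^n\|_0\lesssim(\Delta\tau)^s,\qquad n=0,\dots,N_T,$$ where the hidden constant is independent of $h$ and $\Delta\tau$.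
   Context: **Parabolic problem.** $\Omega\subset\mathbb{R}^d$ ($d\ge1$) is an open bounded rectangular domain (a product of intervals), $0<T<\infty$, $\mathcal{D}>0$ is a constant, $u_0\in H^2(\Omega)\cap H_0^1(\Omega)$, and $u$ solves $$u_t=\mathcal{D}\Delta u+f(t)\ \text{ in }\Omega,\ t_0\le t\le t_0+T;\qquad u(t_0)=u_0;\qquad u(t)=0\text{ on }\partial\Omega.$$ We write $u(t)=u(t,\cdot)$, $f(t)=f(t,\cdot)$; $f^{(\alpha)}$ is the $\alpha$-th derivative with respect to $t$, and bounds on $|f^{(\alpha)}(t)|$ are uniform in $t\in[t_0,t_0+T]$ and in the spatial point. **Norms and constants.** $\|\cdot\|_m$ is the norm of $H^m(\Omega)$ (so $\|\cdot\|_0$ is the $L^2(\Omega)$-norm) and $(\cdot,\cdot)$ the $L^2(\Omega)$ inner product. $a\lesssim b$ means $a\le Cb$ with a constant $C>0$ independent of the mesh size $h$; the constants in the regularity hypotheses may depend on $t_0$ and $T$. $a\eqsim b$ means $a\lesssim b\lesssim a$. **Space discretization.** $\Omega$ is divided uniformly with mesh size $h_i>0$ in direction $x_i$, $h=\max_i h_i$, and the partitions are quasi-uniform: $h\eqsim h_i$ for all $i$. $V_h\subset H_0^1(\Omega)$ is the span of the tensor products $\phi_1^{i_1}(x_1)\cdots\phi_d^{i_d}(x_d)$ of the one-dimensional continuous piecewise linear nodal basis functions vanishing at the endpoints. $P_h:L^2(\Omega)\to V_h$ is the $L^2$-orthogonal projection, and $L_h:V_h\to V_h$ is defined by $(L_hw_h,v_h)=\int_\Omega\mathcal{D}\nabla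 w_h\cdot\nabla v_h\,dx$ for all $w_h,v_h\in V_h$. The semi-discrete solution $u_h:[t_0,t_0+T]\to V_h$ solves $$u_{h,t}+L_hu_h=P_hf,\qquad u_h(t_0)=P_hu_0 .$$ **EIFE-linear method with $s$ nodes.** The interval $[t_0,t_0+T]$ is divided by $t_0=\tau_0<\tau_1<\cdots<\tau_{N_T}=t_0+T$, $\tau_{n+1}=\tau_n+\Delta\tau_n$, $\Delta\tau=\max_n\Delta\tau_n$. Starting from $u_h^0=P_hu_0$, for $n=0,\dots,N_T-1$, $$u_h^{n+1}=e^{-\Delta\tau_nL_h}u_h^n+\Delta\tau_n\sum_{i=1}^sb_i(-\Delta\tau_nL_h)P_hf(\tau_n+c_i\Delta\tau_n),$$ $$b_i(-\tau L_h)=\int_0^1e^{-\tau(1-\theta)L_h}l_i(\theta)\,d\theta,\qquad l_i(\theta)=\prod_{m=1,m\ne i}^s\frac{\theta-c_m}{c_i-c_m}.$$ *)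

theory Defs
  imports "HOL-Analysis.Analysis" "HOL-Library.Multiset"
begin

section \<open>Lebesgue and Sobolev spaces\<close>

text \<open>
  Elements of \<open>L\<^sup>2(\<Omega>)\<close> are represented by real functions on the whole space. Only the values on
  \<open>\<Omega>\<close> matter, and every notion of this section is invariant under changes on a null set.
\<close>

definition L2 :: "(real^'d) set \<Rightarrow> (real^'d \<Rightarrow> real) set" where
  "L2 \<Omega> = {v. v \<in> borel_measurable (lebesgue_on \<Omega>) \<and> integrable (lebesgue_on \<Omega>) (\<lambda>x. (v x)\<^sup>2)}"

definition l2_inner :: "(real^'d) set \<Rightarrow> (real^'d \<Rightarrow> real) \<Rightarrow> (real^'d \<Rightarrow> real) \<Rightarrow> real" where
  "l2_inner \<Omega> v w = (\<integral>x. v x * w x \<partial>lebesgue_on \<Omega>)"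

definition l2_norm :: "(real^'d) set \<Rightarrow> (real^'d \<Rightarrow> real) \<Rightarrow> real" where
  "l2_norm \<Omega> v = sqrt (l2_inner \<Omega> v v)"

definition partial :: "'d \<Rightarrow> (real^'d \<Rightarrow> real) \<Rightarrow> real^'d \<Rightarrow> real" where
  "partial i g x = frechet_derivative g (at x) (axis i 1)"

primrec partials :: "'d list \<Rightarrow> (real^'d \<Rightarrow> real) \<Rightarrow> real^'d \<Rightarrow> real" where
  "partials [] g = g"
| "partials (i # is) g = partial i (partials is g)"

text \<open>
  The space \<open>C\<^sub>c\<^sup>\<infinity>(\<Omega>)\<close>. If all iterated partial derivatives are differentiable everywhere, then
  they are all continuous, so the function is smooth.
\<close>

definition test_functions :: "(real^'d) set \<Rightarrow> (real^'d \<Rightarrow> real) set" where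
  "test_functions \<Omega> = {\<phi>. (\<forall>is. partials is \<phi> differentiable_on UNIV) \<and>
      compact (closure {x. \<phi> x \<noteq> 0}) \<and> closure {x. \<phi> x \<noteq> 0} \<subseteq> \<Omega>}"

text \<open>
  Multi-indices are multisets of coordinate directions: \<open>\<alpha>\<close> prescribes \<open>count \<alpha> i\<close>
  differentiations in direction \<open>i\<close>, and \<open>size \<alpha>\<close> is its order. Partial derivatives of a test
  function commute, so all lists \<open>is\<close> enumerating \<open>\<alpha>\<close> give the same condition.
\<close>

definition has_weak_deriv ::
    "(real^'d) set \<Rightarrow> 'd multiset \<Rightarrow> (real^'d \<Rightarrow> real) \<Rightarrow> (real^'d \<Rightarrow> real) \<Rightarrow> bool" where
  "has_weak_deriv \<Omega> \<alpha> v g \<longleftrightarrow> v \<in> L2 \<Omega> \<and> g \<in> L2 \<Omega> \<and>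
     (\<forall>\<phi>\<in>test_functions \<Omega>. \<forall>is. mset is = \<alpha> \<longrightarrow>
        l2_inner \<Omega> v (partials is \<phi>) = (-1) ^ size \<alpha> * l2_inner \<Omega> g \<phi>)"

text \<open>The weak derivative is unique up to a null set; \<open>SOME\<close> picks a representative.\<close>

definition weak_deriv ::
    "(real^'d) set \<Rightarrow> 'd multiset \<Rightarrow> (real^'d \<Rightarrow> real) \<Rightarrow> real^'d \<Rightarrow> real" where
  "weak_deriv \<Omega> \<alpha> v = (SOME g. has_weak_deriv \<Omega> \<alpha> v g)"

definition sobolev :: "nat \<Rightarrow> (real^'d) set \<Rightarrow> (real^'d \<Rightarrow> real) set" where
  "sobolev m \<Omega> = {v \<in> L2 \<Omega>. \<forall>\<alpha>. size \<alpha> \<le> m \<longrightarrow> (\<exists>g. has_weak_deriv \<Omega> \<alpha> v g)}"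

definition sobolev_norm :: "nat \<Rightarrow> (real^'d) set \<Rightarrow> (real^'d \<Rightarrow> real) \<Rightarrow> real" where
  "sobolev_norm m \<Omega> v = sqrt (\<Sum>\<alpha> | size \<alpha> \<le> m. (l2_norm \<Omega> (weak_deriv \<Omega> \<alpha> v))\<^sup>2)"

text \<open>\<open>H\<^sub>0\<^sup>1(\<Omega>)\<close> is the closure of \<open>C\<^sub>c\<^sup>\<infinity>(\<Omega>)\<close> in \<open>H\<^sup>1(\<Omega>)\<close>.\<close>

definition sobolev_0_1 :: "(real^'d) set \<Rightarrow> (real^'d \<Rightarrow> real) set" where
  "sobolev_0_1 \<Omega> = {v \<in> sobolev 1 \<Omega>.
     \<forall>\<epsilon>>0. \<exists>\<phi>\<in>test_functions \<Omega>. sobolev_norm 1 \<Omega> (\<lambda>x. v x - \<phi> x) < \<epsilon>}"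

definition laplacian :: "(real^'d) set \<Rightarrow> (real^'d \<Rightarrow> real) \<Rightarrow> real^'d \<Rightarrow> real" where
  "laplacian \<Omega> v x = (\<Sum>i\<in>UNIV. weak_deriv \<Omega> {#i, i#} v x)"

text \<open>Time derivative at \<open>t\<close>, relative to the time interval \<open>I\<close>, of a curve in \<open>L\<^sup>2(\<Omega>)\<close>.\<close>

definition has_time_deriv ::
    "(real^'d) set \<Rightarrow> real set \<Rightarrow> (real \<Rightarrow> real^'d \<Rightarrow> real) \<Rightarrow> (real^'d \<Rightarrow> real) \<Rightarrow> real \<Rightarrow> bool" where
  "has_time_deriv \<Omega> I v v' t \<longleftrightarrow>
     ((\<lambda>r. l2_norm \<Omega> (\<lambda>x. (v r x - v t x) / (r - t) - v' x)) \<longlongrightarrow> 0) (at t within I)"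


section \<open>The parabolic problem\<close>

text \<open>
  Strong solutions: the boundary condition is membership in \<open>H\<^sub>0\<^sup>1(\<Omega>)\<close>, and \<open>ut\<close> is the time
  derivative of \<open>u\<close>.
\<close>

definition parabolic_solution ::
    "(real^'d) set \<Rightarrow> real set \<Rightarrow> real \<Rightarrow> real \<Rightarrow> (real \<Rightarrow> real^'d \<Rightarrow> real) \<Rightarrow> (real^'d \<Rightarrow> real) \<Rightarrow>
     (real \<Rightarrow> real^'d \<Rightarrow> real) \<Rightarrow> (real \<Rightarrow> real^'d \<Rightarrow> real) \<Rightarrow> bool" where
  "parabolic_solution \<Omega> I D t0 f u0 u ut \<longleftrightarrow>
     (\<forall>t\<in>I. u t \<in> sobolev 2 \<Omega> \<inter> sobolev_0_1 \<Omega> \<and> ut t \<in> L2 \<Omega> \<and> f t \<in> L2 \<Omega> \<and>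
        has_time_deriv \<Omega> I u (ut t) t \<and>
        (AE x in lebesgue_on \<Omega>. ut t x = D * laplacian \<Omega> (u t) x + f t x)) \<and>
     (AE x in lebesgue_on \<Omega>. u t0 x = u0 x)"


section \<open>Space discretization\<close>

text \<open>
  The domain is \<open>box a b\<close>, with \<open>N i\<close> subintervals in direction \<open>i\<close>.
\<close>

definition mesh_width :: "real^'d \<Rightarrow> real^'d \<Rightarrow> ('d \<Rightarrow> nat) \<Rightarrow> 'd \<Rightarrow> real" where
  "mesh_width a b N i = (b $ i - a $ i) / real (N i)"

definition mesh_size :: "real^'d \<Rightarrow> real^'d \<Rightarrow> ('d \<Rightarrow> nat) \<Rightarrow> real" where
  "mesh_size a b N = Max (range (mesh_width a b N))"

text \<open>\<open>\<kappa>\<close> is the constant hidden in \<open>h \<eqsim> h\<^sub>i\<close>; the other inequality, \<open>h\<^sub>i \<le> h\<close>, is trivial.\<close>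

definition quasi_uniform :: "real \<Rightarrow> real^'d \<Rightarrow> real^'d \<Rightarrow> ('d \<Rightarrow> nat) \<Rightarrow> bool" where
  "quasi_uniform \<kappa> a b N \<longleftrightarrow> (\<forall>i. mesh_size a b N \<le> \<kappa> * mesh_width a b N i)"

text \<open>
  The one-dimensional continuous piecewise linear function with value 1 at the node
  \<open>a $ i + k * mesh_width a b N i\<close> and 0 at all other nodes.
\<close>

definition hat :: "real^'d \<Rightarrow> real^'d \<Rightarrow> ('d \<Rightarrow> nat) \<Rightarrow> 'd \<Rightarrow> nat \<Rightarrow> real \<Rightarrow> real" where
  "hat a b N i k \<xi> =
     max 0 (1 - \<bar>\<xi> - (a $ i + real k * mesh_width a b N i)\<bar> / mesh_width a b N i)"

definition inner_nodes :: "('d \<Rightarrow> nat) \<Rightarrow> ('d \<Rightarrow> nat) set" where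
  "inner_nodes N = {k. \<forall>i. 1 \<le> k i \<and> k i < N i}"

text \<open>Members of \<open>V\<^sub>h\<close> vanish outside the domain, so they are determined by their values on it.\<close>

definition Vh :: "real^'d \<Rightarrow> real^'d \<Rightarrow> ('d \<Rightarrow> nat) \<Rightarrow> (real^'d \<Rightarrow> real) set" where
  "Vh a b N = {v. \<exists>\<gamma>. v = (\<lambda>x. \<Sum>k\<in>inner_nodes N. \<gamma> k * (\<Prod>i\<in>UNIV. hat a b N i (k i) (x $ i)))}"

definition Ph :: "real^'d \<Rightarrow> real^'d \<Rightarrow> ('d \<Rightarrow> nat) \<Rightarrow> (real^'d \<Rightarrow> real) \<Rightarrow> real^'d \<Rightarrow> real" where
  "Ph a b N v = (THE g. g \<in> Vh a b N \<and>
     (\<forall>w\<in>Vh a b N. l2_inner (box a b) (\<lambda>x. v x - g x) w = 0))"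

definition energy_form ::
    "(real^'d) set \<Rightarrow> real \<Rightarrow> (real^'d \<Rightarrow> real) \<Rightarrow> (real^'d \<Rightarrow> real) \<Rightarrow> real" where
  "energy_form \<Omega> D w v =
     (\<integral>x. D * (\<Sum>i\<in>UNIV. weak_deriv \<Omega> {#i#} w x * weak_deriv \<Omega> {#i#} v x) \<partial>lebesgue_on \<Omega>)"

definition Lh ::
    "real^'d \<Rightarrow> real^'d \<Rightarrow> ('d \<Rightarrow> nat) \<Rightarrow> real \<Rightarrow> (real^'d \<Rightarrow> real) \<Rightarrow> real^'d \<Rightarrow> real" where
  "Lh a b N D w = (THE g. g \<in> Vh a b N \<and>
     (\<forall>v\<in>Vh a b N. l2_inner (box a b) g v = energy_form (box a b) D w v))"

definition semidiscrete_solution ::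
    "real^'d \<Rightarrow> real^'d \<Rightarrow> ('d \<Rightarrow> nat) \<Rightarrow> real set \<Rightarrow> real \<Rightarrow> real \<Rightarrow> (real \<Rightarrow> real^'d \<Rightarrow> real) \<Rightarrow>
     (real^'d \<Rightarrow> real) \<Rightarrow> (real \<Rightarrow> real^'d \<Rightarrow> real) \<Rightarrow> bool" where
  "semidiscrete_solution a b N I D t0 f u0 uh \<longleftrightarrow>
     (\<forall>t\<in>I. uh t \<in> Vh a b N \<and>
        (\<exists>w\<in>Vh a b N. has_time_deriv (box a b) I uh w t \<and>
           (\<forall>x. w x + Lh a b N D (uh t) x = Ph a b N (f t) x))) \<and>
     uh t0 = Ph a b N u0"


section \<open>The EIFE-linear method\<close>

text \<open>
  The operators act on the finite-dimensional space \<open>V\<^sub>h\<close>, on which pointwise convergence and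
  \<open>L\<^sup>2\<close> convergence coincide. Hence the exponential series and the operator-valued integral can be
  evaluated pointwise. \<open>op_exp A\<close> is \<open>e\<^sup>A\<close>.
\<close>

definition op_exp ::
    "((real^'d \<Rightarrow> real) \<Rightarrow> real^'d \<Rightarrow> real) \<Rightarrow> (real^'d \<Rightarrow> real) \<Rightarrow> real^'d \<Rightarrow> real" where
  "op_exp A w x = (\<Sum>k. (A ^^ k) w x / fact k)"

text \<open>\<open>exp_Lh a b N D r\<close> is \<open>e\<^sup>-\<^sup>r\<^sup>L\<close> with \<open>L = L\<^sub>h\<close>.\<close>

definition exp_Lh ::
    "real^'d \<Rightarrow> real^'d \<Rightarrow> ('d \<Rightarrow> nat) \<Rightarrow> real \<Rightarrow> real \<Rightarrow> (real^'d \<Rightarrow> real) \<Rightarrow> real^'d \<Rightarrow> real" where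
  "exp_Lh a b N D r = op_exp (\<lambda>w x. - r * Lh a b N D w x)"

definition lagrange :: "nat \<Rightarrow> (nat \<Rightarrow> real) \<Rightarrow> nat \<Rightarrow> real \<Rightarrow> real" where
  "lagrange s c i \<theta> = (\<Prod>m\<in>{1..s} - {i}. (\<theta> - c m) / (c i - c m))"

text \<open>\<open>eife_weight a b N D s c i r\<close> is the operator \<open>b\<^sub>i(-r L\<^sub>h)\<close>.\<close>

definition eife_weight ::
    "real^'d \<Rightarrow> real^'d \<Rightarrow> ('d \<Rightarrow> nat) \<Rightarrow> real \<Rightarrow> nat \<Rightarrow> (nat \<Rightarrow> real) \<Rightarrow> nat \<Rightarrow> real \<Rightarrow>
     (real^'d \<Rightarrow> real) \<Rightarrow> real^'d \<Rightarrow> real" where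
  "eife_weight a b N D s c i r g x =
     integral {0..1} (\<lambda>\<theta>. exp_Lh a b N D (r * (1 - \<theta>)) g x * lagrange s c i \<theta>)"

primrec eife ::
    "real^'d \<Rightarrow> real^'d \<Rightarrow> ('d \<Rightarrow> nat) \<Rightarrow> real \<Rightarrow> nat \<Rightarrow> (nat \<Rightarrow> real) \<Rightarrow>
     (real \<Rightarrow> real^'d \<Rightarrow> real) \<Rightarrow> (real^'d \<Rightarrow> real) \<Rightarrow> (nat \<Rightarrow> real) \<Rightarrow> nat \<Rightarrow> real^'d \<Rightarrow> real" where
  "eife a b N D s c f u0 \<tau> 0 = Ph a b N u0"
| "eife a b N D s c f u0 \<tau> (Suc n) = (\<lambda>x.
     let \<delta> = \<tau> (Suc n) - \<tau> n in
     exp_Lh a b N D \<delta> (eife a b N D s c f u0 \<tau> n) x +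
     \<delta> * (\<Sum>i=1..s. eife_weight a b N D s c i \<delta> (Ph a b N (f (\<tau> n + c i * \<delta>))) x))"

definition time_partition :: "real \<Rightarrow> real \<Rightarrow> nat \<Rightarrow> (nat \<Rightarrow> real) \<Rightarrow> bool" where
  "time_partition t0 T NT \<tau> \<longleftrightarrow> \<tau> 0 = t0 \<and> \<tau> NT = t0 + T \<and> (\<forall>n<NT. \<tau> n < \<tau> (Suc n))"

definition time_step :: "nat \<Rightarrow> (nat \<Rightarrow> real) \<Rightarrow> real" where
  "time_step NT \<tau> = Max ((\<lambda>n. \<tau> (Suc n) - \<tau> n) ` {..<NT})"

end

theory Submission
  imports Defs
begin

text \<open>
  In coordinates of an \<open>L\<^sup>2\<close>-orthonormal basis of \<open>V\<^sub>h\<close> the operator \<open>L\<^sub>h\<close> is a matrix with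
  nonnegative quadratic form, so \<open>e\<^sup>-\<^sup>r\<^sup>L\<close> is a contraction of the Euclidean norm, which is the
  \<open>L\<^sup>2\<close> norm. By Duhamel's formula the scheme differs from the semi-discrete flow on one step
  only in that \<open>P\<^sub>h f\<close> is replaced by its Lagrange interpolant in time. Since \<open>P\<^sub>h\<close> is a contraction
  as well, a step of length \<open>\<delta>\<close> adds at most a constant times \<open>\<delta>\<^sup>s\<^sup>+\<^sup>1\<close> to the error, and these
  errors add up to order \<open>s\<close>. No constant depends on \<open>h\<close>, because only the sign of \<open>L\<^sub>h\<close> is used.

  That \<open>L\<^sub>h\<close> is linear at all requires that weak derivatives of finite element functions exist and
  are unique almost everywhere. Existence follows from difference quotients, uniqueness from
  approximating indicators of boxes by products of bump functions.
\<close>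

section \<open>Exponential integrators for linear systems\<close>

text \<open>\<open>Ph\<close> and \<open>Lh\<close> are picked by \<open>THE\<close>, weak
  derivatives by \<open>SOME\<close>, and the operator exponential and the weights are pointwise
  limits. None of them can be calculated with before existence, uniqueness and linearity are known,
  which is why everything is carried over to coordinate vectors
  \<open>nat \<Rightarrow> real\<close>. The dimension is a number \<open>m\<close> and not a type,
  because it changes with the mesh, which is quantified after the constant. The order s has two
  sources. Interpolation reproduces the Taylor polynomial of degree below s, so only remainders of
  size \<delta>^s survive, and integrating over the step contributes one more factor \<delta>. As a
  step never amplifies the earlier error, these last factors add up to the elapsed time, with no
  exponential growth factor. The constant is therefore built from a bound on the s-th time
  derivative of f, the Lebesgue constant of the nodes, the square root of the volume of the domain,
  and T.\<close>

definition matvec :: "nat \<Rightarrow> (nat \<Rightarrow> nat \<Rightarrow> real) \<Rightarrow> (nat \<Rightarrow> real) \<Rightarrow> nat \<Rightarrow> real" where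
  "matvec m M v i = (\<Sum>j<m. M i j * v j)"

text \<open>The entries of e^(-rM) v. Written in powers of -r with coefficients free of r, the
  series is open to termwise differentiation of power series.\<close>

definition propagator :: "nat \<Rightarrow> (nat \<Rightarrow> nat \<Rightarrow> real) \<Rightarrow> real \<Rightarrow> (nat \<Rightarrow> real) \<Rightarrow> nat \<Rightarrow> real" where
  "propagator m M r v i = (\<Sum>k. (matvec m M ^^ k) v i / fact k * (- r) ^ k)"

lemma matvec_cong: "(\<And>j. j < m \<Longrightarrow> v j = w j) \<Longrightarrow> matvec m M v = matvec m M w"
  by (auto simp: matvec_def fun_eq_iff intro!: sum.cong)

lemma matvec_sum:
  "matvec m M (\<lambda>j. \<Sum>l\<in>I. \<alpha> l * v l j) = (\<lambda>i. \<Sum>l\<in>I. \<alpha> l * matvec m M (v l) i)"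
proof
  fix i
  show "matvec m M (\<lambda>j. \<Sum>l\<in>I. \<alpha> l * v l j) i = (\<Sum>l\<in>I. \<alpha> l * matvec m M (v l) i)"
    unfolding matvec_def sum_distrib_left
    by (subst sum.swap) (simp add: mult.left_commute)
qed

lemma matvec_funpow_sum:
  "(matvec m M ^^ k) (\<lambda>j. \<Sum>l\<in>I. \<alpha> l * v l j) = (\<lambda>i. \<Sum>l\<in>I. \<alpha> l * (matvec m M ^^ k) (v l) i)"
  by (induction k) (simp_all add: matvec_sum)

text \<open>In the 1-norm, one application of the matrix costs at most the sum of the absolute
  values of all its entries. So crude a factor is enough, since it serves only the convergence of
  the exponential series.\<close>

lemma matvec_funpow_bound:
  assumes "i < m"
  shows "\<bar>(matvec m M ^^ k) v i\<bar> \<le> (\<Sum>i<m. \<Sum>j<m. \<bar>M i j\<bar>) ^ k * (\<Sum>j<m. \<bar>v j\<bar>)"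
proof -
  let ?K = "\<Sum>i<m. \<Sum>j<m. \<bar>M i j\<bar>"
  have step: "(\<Sum>i<m. \<bar>matvec m M v i\<bar>) \<le> ?K * (\<Sum>j<m. \<bar>v j\<bar>)" for v
  proof -
    have "\<bar>matvec m M v i\<bar> \<le> (\<Sum>j<m. \<bar>M i j\<bar>) * (\<Sum>j<m. \<bar>v j\<bar>)" for i
    proof -
      have "\<bar>matvec m M v i\<bar> \<le> (\<Sum>j<m. \<bar>M i j\<bar> * \<bar>v j\<bar>)"
        unfolding matvec_def by (rule order_trans[OF sum_abs]) (simp add: abs_mult)
      also have "\<dots> \<le> (\<Sum>j<m. \<bar>M i j\<bar> * (\<Sum>j<m. \<bar>v j\<bar>))"
        by (intro sum_mono mult_left_mono member_le_sum) auto
      finally show ?thesis by (simp add: sum_distrib_right)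
    qed
    then show ?thesis by (simp add: sum_distrib_right sum_mono)
  qed
  have "(\<Sum>i<m. \<bar>(matvec m M ^^ k) v i\<bar>) \<le> ?K ^ k * (\<Sum>j<m. \<bar>v j\<bar>)"
  proof (induction k)
    case (Suc k)
    have "(\<Sum>i<m. \<bar>(matvec m M ^^ Suc k) v i\<bar>) \<le> ?K * (\<Sum>j<m. \<bar>(matvec m M ^^ k) v j\<bar>)"
      using step by simp
    also have "\<dots> \<le> ?K * (?K ^ k * (\<Sum>j<m. \<bar>v j\<bar>))"
      by (intro mult_left_mono Suc sum_nonneg) auto
    finally show ?case by (simp add: mult.assoc)
  qed simp
  moreover have "\<bar>(matvec m M ^^ k) v i\<bar> \<le> (\<Sum>i<m. \<bar>(matvec m M ^^ k) v i\<bar>)"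
    using assms by (intro member_le_sum[of i "{..<m}" "\<lambda>i. \<bar>(matvec m M ^^ k) v i\<bar>"]) auto
  ultimately show ?thesis by linarith
qed

lemma propagator_summable:
  assumes "i < m"
  shows "summable (\<lambda>k. (matvec m M ^^ k) v i / fact k * x ^ k)"
proof (rule summable_comparison_test)
  let ?K = "\<Sum>i<m. \<Sum>j<m. \<bar>M i j\<bar>" and ?B = "\<Sum>j<m. \<bar>v j\<bar>"
  show "summable (\<lambda>k. ?B * (inverse (fact k) * (?K * \<bar>x\<bar>) ^ k))"
    by (intro summable_mult summable_exp)
  show "\<exists>N. \<forall>k\<ge>N. norm ((matvec m M ^^ k) v i / fact k * x ^ k)
      \<le> ?B * (inverse (fact k) * (?K * \<bar>x\<bar>) ^ k)"
  proof (intro exI[of _ 0] allI impI)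
    fix k
    have "norm ((matvec m M ^^ k) v i / fact k * x ^ k)
        = \<bar>(matvec m M ^^ k) v i\<bar> * (inverse (fact k) * \<bar>x\<bar> ^ k)"
      by (simp add: abs_mult power_abs divide_inverse mult.assoc)
    also have "\<dots> \<le> (?K ^ k * ?B) * (inverse (fact k) * \<bar>x\<bar> ^ k)"
      by (intro mult_right_mono matvec_funpow_bound assms) auto
    finally show "norm ((matvec m M ^^ k) v i / fact k * x ^ k)
      \<le> ?B * (inverse (fact k) * (?K * \<bar>x\<bar>) ^ k)"
      by (simp add: power_mult_distrib mult_ac)
  qed
qed

lemma propagator_0 [simp]: "propagator m M 0 v i = v i"
  using powser_zero[of "\<lambda>k. (matvec m M ^^ k) v i / fact k"] by (simp add: propagator_def)

lemma propagator_sum: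
  assumes "i < m" "finite I"
  shows "propagator m M r (\<lambda>j. \<Sum>l\<in>I. \<alpha> l * v l j) i = (\<Sum>l\<in>I. \<alpha> l * propagator m M r (v l) i)"
proof -
  have "propagator m M r (\<lambda>j. \<Sum>l\<in>I. \<alpha> l * v l j) i
      = (\<Sum>k. \<Sum>l\<in>I. \<alpha> l * ((matvec m M ^^ k) (v l) i / fact k * (- r) ^ k))"
    by (simp add: propagator_def matvec_funpow_sum sum_divide_distrib sum_distrib_right mult.assoc)
  also have "\<dots> = (\<Sum>l\<in>I. \<Sum>k. \<alpha> l * ((matvec m M ^^ k) (v l) i / fact k * (- r) ^ k))"
    by (intro suminf_sum summable_mult propagator_summable assms)
  also have "\<dots> = (\<Sum>l\<in>I. \<alpha> l * propagator m M r (v l) i)"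
    unfolding propagator_def by (intro sum.cong refl suminf_mult propagator_summable assms)
  finally show ?thesis .
qed

lemma propagator_cong:
  assumes "\<And>j. j < m \<Longrightarrow> v j = w j" "i < m"
  shows "propagator m M r v i = propagator m M r w i"
proof -
  \<comment> \<open>For k = 0 the entry \<open>v i\<close> itself is read, which needs
    \<open>i < m\<close>; for larger k the innermost application already sees only entries below
    m.\<close>
  have "(matvec m M ^^ k) v i = (matvec m M ^^ k) w i" for k
    using assms matvec_cong[OF assms(1)] by (cases k) (simp_all add: funpow_swap1)
  then show ?thesis by (simp add: propagator_def)
qed

text \<open>Separates the dependence on r from the dependence on v, which permits the product rule
  when both vary with time.\<close>

lemma propagator_units:
  assumes "i < m"
  shows "propagator m M r v i = (\<Sum>l<m. v l * propagator m M r (\<lambda>j. of_bool (l = j)) i)"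
proof -
  have "propagator m M r v i = propagator m M r (\<lambda>j. \<Sum>l<m. v l * of_bool (l = j)) i"
    using assms by (intro propagator_cong) (auto simp: of_bool_def if_distrib cong: if_cong)
  then show ?thesis by (simp only: propagator_sum[OF assms finite_lessThan])
qed

lemma matvec_propagator:
  assumes "i < m"
  shows "propagator m M r (matvec m M v) i = matvec m M (propagator m M r v) i"
proof -
  have "matvec m M (propagator m M r v) i
      = (\<Sum>j<m. M i j * (\<Sum>k. (matvec m M ^^ k) v j / fact k * (- r) ^ k))"
    by (simp add: matvec_def propagator_def)
  also have "\<dots> = (\<Sum>j<m. \<Sum>k. M i j * ((matvec m M ^^ k) v j / fact k * (- r) ^ k))"
    by (intro sum.cong refl suminf_mult[symmetric] propagator_summable) auto
  also have "\<dots> = (\<Sum>k. \<Sum>j<m. M i j * ((matvec m M ^^ k) v j / fact k * (- r) ^ k))"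
    by (intro suminf_sum[symmetric] summable_mult propagator_summable) auto
  also have "\<dots> = (\<Sum>k. matvec m M ((matvec m M ^^ k) v) i / fact k * (- r) ^ k)"
    by (simp add: matvec_def sum_divide_distrib sum_distrib_right mult.assoc)
  also have "\<dots> = propagator m M r (matvec m M v) i"
    by (simp add: propagator_def funpow_swap1)
  finally show ?thesis by simp
qed

text \<open>Differentiating the exponential series shifts its coefficients by one, which amounts to
  replacing v by Mv; the sign is the inner derivative of -r.\<close>

lemma propagator_deriv:
  assumes "i < m"
  shows "((\<lambda>r. propagator m M r v i) has_real_derivative - propagator m M r (matvec m M v) i) (at r)"
proof -
  let ?c = "\<lambda>k. (matvec m M ^^ k) v i / fact k"
  have diffs: "diffs ?c = (\<lambda>k. (matvec m M ^^ k) (matvec m M v) i / fact k)"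
    by (auto simp: diffs_def fun_eq_iff funpow_swap1 field_simps simp del: of_nat_Suc)
  have "((\<lambda>x. \<Sum>k. ?c k * x ^ k) has_real_derivative (\<Sum>k. diffs ?c k * (- r) ^ k)) (at (- r))"
    by (rule termdiffs_strong_converges_everywhere) (rule propagator_summable[OF assms])
  then have "((\<lambda>r. \<Sum>k. ?c k * (- r) ^ k) has_real_derivative (\<Sum>k. diffs ?c k * (- r) ^ k) * (- 1)) (at r)"
    by (rule DERIV_chain2) (auto intro!: derivative_eq_intros)
  then show ?thesis unfolding diffs propagator_def by simp
qed

text \<open>Energy method: the squared norm of the propagated vector has derivative -2 times the
  quadratic form of M at that vector, hence decreases. No spectral decomposition enters, and the
  bound does not see the size of M.\<close>

lemma propagator_contraction:
  assumes nonneg: "\<And>v. 0 \<le> (\<Sum>i<m. matvec m M v i * v i)" and "0 \<le> r"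
  shows "L2_set (propagator m M r v) {..<m} \<le> L2_set v {..<m}"
proof -
  define g where "g r = (\<Sum>i<m. (propagator m M r v i)\<^sup>2)" for r
  have g': "(g has_real_derivative - 2 * (\<Sum>i<m. matvec m M (propagator m M r v) i * propagator m M r v i)) (at r)" for r
    unfolding g_def
    apply (rule derivative_eq_intros propagator_deriv | simp)+
    apply (simp add: sum_distrib_left matvec_propagator mult_ac sum_negf)
    done
  have "g r \<le> g 0"
    using assms(2)
  proof (rule DERIV_nonpos_imp_nonincreasing)
    fix x
    have "- 2 * (\<Sum>i<m. matvec m M (propagator m M x v) i * propagator m M x v i) \<le> 0"
      using nonneg[of "propagator m M x v"] by simp
    with g'[of x] show "\<exists>y. (g has_real_derivative y) (at x) \<and> y \<le> 0" by blast
  qed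
  then show ?thesis by (simp add: g_def L2_set_def)
qed

lemma continuous_on_propagator:
  assumes "i < m"
  shows "continuous_on S (\<lambda>r. propagator m M r v i)"
  using propagator_deriv[OF assms] by (intro DERIV_continuous_on) (auto intro: has_field_derivative_at_within)

text \<open>The propagator is an integrating factor for y' = p - My: differentiating it contributes
  the propagated My, which cancels the one coming from the equation.\<close>

lemma propagator_duhamel_deriv:
  assumes "i < m"
    and y: "\<And>j. j < m \<Longrightarrow> ((\<lambda>t. y t j) has_real_derivative p j - matvec m M (y t) j) (at t within S)"
  shows "((\<lambda>t. propagator m M (t1 - t) (y t) i) has_real_derivative propagator m M (t1 - t) p i) (at t within S)"
proof -
  define E where "E l r = propagator m M r (\<lambda>j. of_bool (l = j)) i" for l r
  define E' where "E' l r = propagator m M r (matvec m M (\<lambda>j. of_bool (l = j))) i" for l r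
  have E: "((\<lambda>t. E l (t1 - t)) has_real_derivative E' l (t1 - t)) (at t within S)" for l
  proof -
    have "((\<lambda>r. E l r) has_real_derivative - E' l (t1 - t)) (at (t1 - t))"
      unfolding E_def E'_def by (rule propagator_deriv[OF assms(1)])
    then have "((\<lambda>t. E l (t1 - t)) has_real_derivative - E' l (t1 - t) * (- 1)) (at t within S)"
      by (rule DERIV_chain2) (auto intro!: derivative_eq_intros)
    then show ?thesis by simp
  qed
  have expand: "propagator m M r v i = (\<Sum>l<m. v l * E l r)" for r v
    unfolding E_def by (rule propagator_units[OF assms(1)])
  \<comment> \<open>The summands with \<open>E'\<close> reassemble into the propagator applied to
    My, the term to be cancelled.\<close>
  have "(\<Sum>l<m. y t l * E' l (t1 - t)) = propagator m M (t1 - t) (matvec m M (y t)) i"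
  proof -
    have "matvec m M (y t) = matvec m M (\<lambda>j. \<Sum>l<m. y t l * of_bool (l = j))"
      by (rule matvec_cong) (simp add: of_bool_def if_distrib cong: if_cong)
    then show ?thesis unfolding E'_def by (simp only: matvec_sum propagator_sum[OF assms(1) finite_lessThan])
  qed
  then have eq: "(\<Sum>l<m. (p l - matvec m M (y t) l) * E l (t1 - t) + E' l (t1 - t) * y t l) = propagator m M (t1 - t) p i"
    unfolding expand by (simp only: sum.distrib sum_subtractf left_diff_distrib mult.commute[of "E' _ _"])
  have "((\<lambda>t. \<Sum>l<m. y t l * E l (t1 - t)) has_real_derivative
      (\<Sum>l<m. (p l - matvec m M (y t) l) * E l (t1 - t) + E' l (t1 - t) * y t l)) (at t within S)"
    by (intro DERIV_sum DERIV_mult y E) auto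
  then show ?thesis unfolding eq unfolding expand .
qed

text \<open>
  Testing with the new error \<open>w\<close> itself bounds its norm by \<open>\<parallel>y(\<tau>) - U\<parallel> + \<delta> R\<close> without estimating
  vector-valued integrals. The integral \<open>\<integral> p\<close> exists by the fundamental theorem of calculus,
  so no regularity of \<open>p\<close> is needed.
\<close>

lemma exponential_quadrature_step:
  fixes \<tau> \<delta> :: real
  assumes nonneg: "\<And>v. 0 \<le> (\<Sum>i<m. matvec m M v i * v i)" and "0 < \<delta>"
    and y: "\<And>t j. t \<in> {\<tau>..\<tau> + \<delta>} \<Longrightarrow> j < m \<Longrightarrow>
        ((\<lambda>t. y t j) has_real_derivative p t j - matvec m M (y t) j) (at t within {\<tau>..\<tau> + \<delta>})"
    and l: "\<And>q. q \<in> Q \<Longrightarrow> continuous_on {0..1} (l q)" and "finite Q"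
    and R: "\<And>\<theta>. \<theta> \<in> {0..1} \<Longrightarrow> L2_set (\<lambda>j. p (\<tau> + \<theta> * \<delta>) j - (\<Sum>q\<in>Q. l q \<theta> * F q j)) {..<m} \<le> R"
    and U': "\<And>i. i < m \<Longrightarrow> U' i = propagator m M \<delta> U i +
        \<delta> * (\<Sum>q\<in>Q. integral {0..1} (\<lambda>\<theta>. propagator m M (\<delta> * (1 - \<theta>)) (F q) i * l q \<theta>))"
  shows "L2_set (\<lambda>i. y (\<tau> + \<delta>) i - U' i) {..<m} \<le> L2_set (\<lambda>i. y \<tau> i - U i) {..<m} + \<delta> * R"
proof -
  define w where "w i = y (\<tau> + \<delta>) i - U' i" for i
  define e where "e i = y \<tau> i - U i" for i
  define G where "G \<theta> j = p (\<tau> + \<theta> * \<delta>) j - (\<Sum>q\<in>Q. l q \<theta> * F q j)" for \<theta> j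
  let ?S = "propagator m M"
  \<comment> \<open>Duhamel's formula for the error. \<open>G \<theta>\<close> is the defect of the
    interpolant at relative time \<theta>; the factor \<open>\<delta>\<close> comes from
    substituting t = \<tau> + \<theta> \<delta>, which moves the step to the unit interval on which
    the weights are defined.\<close>
  have int_i: "((\<lambda>\<theta>. \<delta> * ?S (\<delta> * (1 - \<theta>)) (G \<theta>) i) has_integral w i - ?S \<delta> e i) {0..1}" if i: "i < m" for i
  proof -
    have d: "((\<lambda>\<theta>. ?S (\<tau> + \<delta> - (\<tau> + \<theta> * \<delta>)) (y (\<tau> + \<theta> * \<delta>)) i) has_real_derivative
        ?S (\<tau> + \<delta> - (\<tau> + \<theta> * \<delta>)) (p (\<tau> + \<theta> * \<delta>)) i * \<delta>) (at \<theta> within {0..1})" if "\<theta> \<in> {0..1}" for \<theta>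
    proof -
      have im: "(\<lambda>\<theta>. \<tau> + \<theta> * \<delta>) ` {0..1} \<subseteq> {\<tau>..\<tau> + \<delta>}"
        using \<open>0 < \<delta>\<close> by (auto simp: mult_left_le_one_le)
      have "((\<lambda>t. ?S (\<tau> + \<delta> - t) (y t) i) has_real_derivative ?S (\<tau> + \<delta> - (\<tau> + \<theta> * \<delta>)) (p (\<tau> + \<theta> * \<delta>)) i)
         (at (\<tau> + \<theta> * \<delta>) within {\<tau>..\<tau> + \<delta>})"
        by (rule propagator_duhamel_deriv[OF i y[OF subsetD[OF im imageI[OF that]]]])
      then have "((\<lambda>t. ?S (\<tau> + \<delta> - t) (y t) i) has_real_derivative ?S (\<tau> + \<delta> - (\<tau> + \<theta> * \<delta>)) (p (\<tau> + \<theta> * \<delta>)) i)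
         (at (\<tau> + \<theta> * \<delta>) within (\<lambda>\<theta>. \<tau> + \<theta> * \<delta>) ` {0..1})"
        using im by (rule DERIV_subset)
      moreover have "((\<lambda>\<theta>. \<tau> + \<theta> * \<delta>) has_real_derivative \<delta>) (at \<theta> within {0..1})"
        by (auto intro!: derivative_eq_intros)
      ultimately show ?thesis by (rule DERIV_image_chain[unfolded o_def])
    qed
    have "((\<lambda>\<theta>. ?S (\<tau> + \<delta> - (\<tau> + \<theta> * \<delta>)) (p (\<tau> + \<theta> * \<delta>)) i * \<delta>) has_integral
        ?S (\<tau> + \<delta> - (\<tau> + 1 * \<delta>)) (y (\<tau> + 1 * \<delta>)) i - ?S (\<tau> + \<delta> - (\<tau> + 0 * \<delta>)) (y (\<tau> + 0 * \<delta>)) i) {0..1}"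
      by (rule fundamental_theorem_of_calculus[where f = "\<lambda>\<theta>. ?S (\<tau> + \<delta> - (\<tau> + \<theta> * \<delta>)) (y (\<tau> + \<theta> * \<delta>)) i",
            OF zero_le_one d[unfolded has_real_derivative_iff_has_vector_derivative]])
    then have 1: "((\<lambda>\<theta>. ?S (\<delta> * (1 - \<theta>)) (p (\<tau> + \<theta> * \<delta>)) i * \<delta>) has_integral y (\<tau> + \<delta>) i - ?S \<delta> (y \<tau>) i) {0..1}"
      by (simp add: algebra_simps)
    have "((\<lambda>\<theta>. ?S (\<delta> * (1 - \<theta>)) (F q) i * l q \<theta>) has_integral
        integral {0..1} (\<lambda>\<theta>. ?S (\<delta> * (1 - \<theta>)) (F q) i * l q \<theta>)) {0..1}" if "q \<in> Q" for q
      by (intro integrable_integral integrable_continuous_interval continuous_on_mult l that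
           continuous_on_compose2[OF continuous_on_propagator[OF i, of UNIV]] continuous_intros) auto
    then have 2: "((\<lambda>\<theta>. \<Sum>q\<in>Q. ?S (\<delta> * (1 - \<theta>)) (F q) i * l q \<theta>) has_integral
        (\<Sum>q\<in>Q. integral {0..1} (\<lambda>\<theta>. ?S (\<delta> * (1 - \<theta>)) (F q) i * l q \<theta>))) {0..1}"
      by (intro has_integral_sum \<open>finite Q\<close>) auto
    have lin: "?S r (\<lambda>j. v j - v' j) i = ?S r v i - ?S r v' i" for r v v'
      unfolding propagator_units[OF i, of M r "\<lambda>j. v j - v' j"]
        propagator_units[OF i, of M r v] propagator_units[OF i, of M r v']
      by (simp add: left_diff_distrib sum_subtractf)
    have "((\<lambda>\<theta>. ?S (\<delta> * (1 - \<theta>)) (p (\<tau> + \<theta> * \<delta>)) i * \<delta> -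
          \<delta> * (\<Sum>q\<in>Q. ?S (\<delta> * (1 - \<theta>)) (F q) i * l q \<theta>)) has_integral
        y (\<tau> + \<delta>) i - ?S \<delta> (y \<tau>) i -
          \<delta> * (\<Sum>q\<in>Q. integral {0..1} (\<lambda>\<theta>. ?S (\<delta> * (1 - \<theta>)) (F q) i * l q \<theta>))) {0..1}"
      by (intro has_integral_diff has_integral_mult_right 1 2)
    moreover have "w i - ?S \<delta> e i = y (\<tau> + \<delta>) i - ?S \<delta> (y \<tau>) i -
          \<delta> * (\<Sum>q\<in>Q. integral {0..1} (\<lambda>\<theta>. ?S (\<delta> * (1 - \<theta>)) (F q) i * l q \<theta>))"
      by (simp add: w_def e_def[abs_def] U'[OF i] lin)
    moreover have "\<delta> * ?S (\<delta> * (1 - \<theta>)) (G \<theta>) i = ?S (\<delta> * (1 - \<theta>)) (p (\<tau> + \<theta> * \<delta>)) i * \<delta> -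
          \<delta> * (\<Sum>q\<in>Q. ?S (\<delta> * (1 - \<theta>)) (F q) i * l q \<theta>)" for \<theta>
      unfolding G_def[abs_def] lin propagator_sum[OF i \<open>finite Q\<close>] by (simp add: algebra_simps)
    ultimately show ?thesis by simp
  qed
  have CS: "\<bar>\<Sum>i<m. v i * w i\<bar> \<le> L2_set v {..<m} * L2_set w {..<m}" for v
    by (rule order_trans[OF sum_abs]) (simp add: abs_mult L2_set_mult_ineq)
  have "((\<lambda>\<theta>. \<Sum>i<m. (\<delta> * ?S (\<delta> * (1 - \<theta>)) (G \<theta>) i) * w i) has_integral (\<Sum>i<m. (w i - ?S \<delta> e i) * w i)) {0..1}"
    by (intro has_integral_sum has_integral_mult_left int_i) auto
  moreover have "norm (\<Sum>i<m. (\<delta> * ?S (\<delta> * (1 - \<theta>)) (G \<theta>) i) * w i) \<le> \<delta> * (R * L2_set w {..<m})" if "\<theta> \<in> {0..1}" for \<theta>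
  proof -
    have "norm (\<Sum>i<m. (\<delta> * ?S (\<delta> * (1 - \<theta>)) (G \<theta>) i) * w i) = \<delta> * \<bar>\<Sum>i<m. ?S (\<delta> * (1 - \<theta>)) (G \<theta>) i * w i\<bar>"
      using \<open>0 < \<delta>\<close> by (simp add: mult.assoc abs_mult flip: sum_distrib_left)
    also have "\<dots> \<le> \<delta> * (L2_set (?S (\<delta> * (1 - \<theta>)) (G \<theta>)) {..<m} * L2_set w {..<m})"
      using \<open>0 < \<delta>\<close> by (intro mult_left_mono CS) auto
    also have "\<dots> \<le> \<delta> * (R * L2_set w {..<m})"
    proof -
      have "L2_set (?S (\<delta> * (1 - \<theta>)) (G \<theta>)) {..<m} \<le> L2_set (G \<theta>) {..<m}"
        using that \<open>0 < \<delta>\<close> by (intro propagator_contraction nonneg) auto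
      also have "\<dots> \<le> R" unfolding G_def using R that by auto
      finally show ?thesis using \<open>0 < \<delta>\<close> by (intro mult_left_mono mult_right_mono) auto
    qed
    finally show ?thesis .
  qed
  moreover have "0 \<le> R" using order_trans[OF L2_set_nonneg R[of 0]] by simp
  ultimately have "norm (\<Sum>i<m. (w i - ?S \<delta> e i) * w i) \<le> \<delta> * (R * L2_set w {..<m}) * measure lborel (cbox 0 (1::real))"
    using \<open>0 < \<delta>\<close> by (intro has_integral_bound) (auto simp: cbox_interval)
  then have "(\<Sum>i<m. (w i)\<^sup>2) \<le> (\<Sum>i<m. ?S \<delta> e i * w i) + \<delta> * R * L2_set w {..<m}"
    by (simp add: left_diff_distrib sum_subtractf power2_eq_square abs_le_iff mult.assoc)
  also have "\<dots> \<le> L2_set (?S \<delta> e) {..<m} * L2_set w {..<m} + \<delta> * R * L2_set w {..<m}"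
    using CS[of "?S \<delta> e"] by (simp add: abs_le_iff)
  also have "\<dots> \<le> L2_set e {..<m} * L2_set w {..<m} + \<delta> * R * L2_set w {..<m}"
    using propagator_contraction[OF nonneg, of \<delta> e] \<open>0 < \<delta>\<close>
    by (intro add_right_mono mult_right_mono) auto
  finally have "L2_set w {..<m} * L2_set w {..<m} \<le> (L2_set e {..<m} + \<delta> * R) * L2_set w {..<m}"
    by (simp add: L2_set_def sum_nonneg algebra_simps)
  moreover have "0 \<le> L2_set e {..<m} + \<delta> * R" using \<open>0 \<le> R\<close> \<open>0 < \<delta>\<close> by simp
  \<comment> \<open>One factor, the norm of \<open>w\<close>, is cancelled; if it is zero, the claim
    is the nonnegativity of the right-hand side.\<close>
  ultimately have "L2_set w {..<m} \<le> L2_set e {..<m} + \<delta> * R"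
    using L2_set_nonneg[of w "{..<m}"] by (cases "L2_set w {..<m} = 0") (auto simp: mult_le_cancel_right)
  then show ?thesis unfolding w_def[abs_def] e_def[abs_def] .
qed

section \<open>Lagrange interpolation in time\<close>

lemma lagrange_node:
  assumes "inj_on c {1..s}" "i \<in> {1..s}" "k \<in> {1..s}"
  shows "lagrange s c i (c k) = of_bool (i = k)"
proof (cases "i = k")
  case True
  have "(c i - c m) / (c i - c m) = 1" if "m \<in> {1..s} - {i}" for m
  proof -
    have "c i \<noteq> c m" using inj_on_eq_iff[OF assms(1,2), of m] that by auto
    then show ?thesis by simp
  qed
  then have "(\<Prod>m\<in>{1..s} - {i}. (c i - c m) / (c i - c m)) = 1"
    by (rule prod.neutral[OF ballI])
  then show ?thesis unfolding lagrange_def True[symmetric] by (simp only: refl of_bool_eq)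
next
  case False
  have "(\<Prod>m\<in>{1..s} - {i}. (c k - c m) / (c i - c m)) = 0"
    by (rule prod_zero) (use False assms in \<open>auto intro!: bexI[of _ k]\<close>)
  then show ?thesis unfolding lagrange_def using False by (simp only: of_bool_eq)
qed

text \<open>Both sides are polynomials in \<theta> of degree below s, and they agree at the s
  distinct nodes.\<close>

lemma lagrange_exact:
  assumes inj: "inj_on c {1..s}" and deg: "degree q < s"
  shows "(\<Sum>i=1..s. lagrange s c i \<theta> * poly q (c i)) = poly q \<theta>"
proof -
  \<comment> \<open>\<open>lagrange\<close> is a mere function, so the degree argument needs a
    polynomial that evaluates to it.\<close>
  define L where "L i = (\<Prod>m\<in>{1..s} - {i}. smult (1 / (c i - c m)) [:- c m, 1:])" for i
  define P where "P = (\<Sum>i=1..s. smult (poly q (c i)) (L i))"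
  have L: "poly (L i) x = lagrange s c i x" for i x
    unfolding L_def lagrange_def poly_prod by (intro prod.cong refl) (simp add: diff_divide_distrib)
  have "degree (L i) < s" if "i \<in> {1..s}" for i
  proof -
    have "degree (L i) \<le> (\<Sum>m\<in>{1..s} - {i}. degree (smult (1 / (c i - c m)) [:- c m, 1:]))"
      unfolding L_def by (rule order_trans[OF degree_prod_sum_le]) (simp_all add: o_def)
    also have "\<dots> \<le> (\<Sum>m\<in>{1..s} - {i}. 1)"
      by (intro sum_mono) (simp add: degree_smult_le)
    also have "\<dots> < s" using that by simp
    finally show ?thesis .
  qed
  then have degP: "degree P < s"
    unfolding P_def using deg by (intro degree_sum_less) (simp_all add: le_less_trans[OF degree_smult_le])
  have "P = q"
  proof (rule poly_eqI_degree)
    show "degree P < card (c ` {1..s})" "degree q < card (c ` {1..s})"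
      using degP deg unfolding card_image[OF inj] by simp_all
    fix x assume "x \<in> c ` {1..s}"
    then obtain k where k: "k \<in> {1..s}" "x = c k" by auto
    have "poly P x = (\<Sum>i=1..s. if i = k then poly q (c i) else 0)"
      unfolding P_def poly_sum by (intro sum.cong refl) (simp add: L k(2) lagrange_node[OF inj _ k(1)])
    then show "poly P x = poly q x" using k by simp
  qed
  moreover have "poly P \<theta> = (\<Sum>i=1..s. lagrange s c i \<theta> * poly q (c i))"
    unfolding P_def poly_sum by (simp add: L mult.commute)
  ultimately show ?thesis by simp
qed

lemma continuous_on_lagrange: "continuous_on S (lagrange s c i)"
  unfolding lagrange_def[abs_def] divide_inverse by (intro continuous_intros)

text \<open>Integral form of the remainder: the kernel (t - x)^(s-1)/(s-1)! is at most
  \<delta>^(s-1), and the length of the interval supplies the last factor \<delta>. Integrability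
  comes with the formula, so a bound on \<open>F s\<close> is enough.\<close>

lemma taylor_remainder_bound:
  fixes F :: "nat \<Rightarrow> real \<Rightarrow> real"
  assumes "s \<ge> 1" "\<tau> \<le> t" "t \<le> \<tau> + \<delta>"
    and F: "\<And>\<alpha> r. \<alpha> < s \<Longrightarrow> r \<in> {\<tau>..\<tau> + \<delta>} \<Longrightarrow>
        (F \<alpha> has_real_derivative F (Suc \<alpha>) r) (at r within {\<tau>..\<tau> + \<delta>})"
    and M: "\<And>r. r \<in> {\<tau>..\<tau> + \<delta>} \<Longrightarrow> \<bar>F s r\<bar> \<le> M"
  shows "\<bar>F 0 t - (\<Sum>i<s. (t - \<tau>) ^ i / fact i * F i \<tau>)\<bar> \<le> M * \<delta> ^ s"
proof -
  have "0 \<le> M" "0 \<le> \<delta>" using M[of \<tau>] assms(2,3) by auto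
  have "((\<lambda>x. ((t - x) ^ (s - 1) / fact (s - 1)) *\<^sub>R F s x) has_integral
      F 0 t - (\<Sum>i<s. ((t - \<tau>) ^ i / fact i) *\<^sub>R F i \<tau>)) {\<tau>..t}"
  proof (rule Taylor_has_integral)
    fix \<alpha> r assume "\<alpha> < s" "\<tau> \<le> r" "r \<le> t"
    with \<open>t \<le> \<tau> + \<delta>\<close> have "(F \<alpha> has_real_derivative F (Suc \<alpha>) r) (at r within {\<tau>..t})"
      by (intro DERIV_subset[OF F]) auto
    then show "(F \<alpha> has_vector_derivative F (Suc \<alpha>) r) (at r within {\<tau>..t})"
      by (simp add: has_real_derivative_iff_has_vector_derivative)
  qed (use assms(1,2) in auto)
  then have "norm (F 0 t - (\<Sum>i<s. ((t - \<tau>) ^ i / fact i) *\<^sub>R F i \<tau>)) \<le> (\<delta> ^ (s - 1) * M) * measure lborel (cbox \<tau> t)"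
    unfolding cbox_interval[symmetric]
  proof (rule has_integral_bound[rotated])
    show "0 \<le> \<delta> ^ (s - 1) * M" using \<open>0 \<le> M\<close> \<open>0 \<le> \<delta>\<close> by simp
    fix x assume x: "x \<in> cbox \<tau> t"
    have "(t - x) ^ (s - 1) / fact (s - 1) \<le> \<delta> ^ (s - 1) / 1"
      using x assms(2,3) by (intro frac_le power_mono) auto
    then have "\<bar>(t - x) ^ (s - 1) / fact (s - 1)\<bar> \<le> \<delta> ^ (s - 1)"
      using x by simp
    then show "norm (((t - x) ^ (s - 1) / fact (s - 1)) *\<^sub>R F s x) \<le> \<delta> ^ (s - 1) * M"
      using x assms(2,3) unfolding real_scaleR_def real_norm_def abs_mult by (intro mult_mono M) auto
  qed
  also have "\<dots> \<le> (\<delta> ^ (s - 1) * M) * \<delta>"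
    using assms(2,3) \<open>0 \<le> M\<close> \<open>0 \<le> \<delta>\<close> by (intro mult_left_mono) auto
  also have "\<dots> = M * \<delta> ^ s" using \<open>s \<ge> 1\<close> by (cases s) auto
  finally show ?thesis by simp
qed

text \<open>Split F into its Taylor polynomial and a remainder. Interpolation reproduces the
  polynomial; what is left is the remainder at \<theta> and, weighted by the Lagrange polynomials,
  at the nodes. Hence the factor one plus their absolute sum.\<close>

lemma lagrange_interpolation_error:
  fixes F :: "nat \<Rightarrow> real \<Rightarrow> real"
  assumes "s \<ge> 1" "0 \<le> \<delta>" and inj: "inj_on c {1..s}" and c: "\<And>i. i \<in> {1..s} \<Longrightarrow> c i \<in> {0..1}"
    and F: "\<And>\<alpha> r. \<alpha> < s \<Longrightarrow> r \<in> {\<tau>..\<tau> + \<delta>} \<Longrightarrow>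
        (F \<alpha> has_real_derivative F (Suc \<alpha>) r) (at r within {\<tau>..\<tau> + \<delta>})"
    and M: "\<And>r. r \<in> {\<tau>..\<tau> + \<delta>} \<Longrightarrow> \<bar>F s r\<bar> \<le> M"
    and \<theta>: "\<theta> \<in> {0..1}"
  shows "\<bar>F 0 (\<tau> + \<theta> * \<delta>) - (\<Sum>i=1..s. lagrange s c i \<theta> * F 0 (\<tau> + c i * \<delta>))\<bar>
      \<le> M * \<delta> ^ s * (1 + (\<Sum>i=1..s. \<bar>lagrange s c i \<theta>\<bar>))"
proof -
  \<comment> \<open>The Taylor polynomial at the left end, in the relative time \<theta>; this
    rescaling puts the powers of \<delta> into the coefficients.\<close>
  define q where "q = (\<Sum>i<s. monom (\<delta> ^ i / fact i * F i \<tau>) i)"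
  define \<rho> where "\<rho> t = F 0 (\<tau> + t * \<delta>) - poly q t" for t
  have \<rho>: "\<bar>\<rho> t\<bar> \<le> M * \<delta> ^ s" if "t \<in> {0..1}" for t
  proof -
    have "poly q t = (\<Sum>i<s. (\<tau> + t * \<delta> - \<tau>) ^ i / fact i * F i \<tau>)"
      by (simp add: q_def poly_sum poly_monom power_mult_distrib mult_ac)
    moreover have "\<bar>F 0 (\<tau> + t * \<delta>) - (\<Sum>i<s. (\<tau> + t * \<delta> - \<tau>) ^ i / fact i * F i \<tau>)\<bar> \<le> M * \<delta> ^ s"
    proof (rule taylor_remainder_bound[where F = F])
      show "\<tau> \<le> \<tau> + t * \<delta>" "\<tau> + t * \<delta> \<le> \<tau> + \<delta>"
        using that \<open>0 \<le> \<delta>\<close> by (auto simp: mult_left_le_one_le)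
    qed (use \<open>s \<ge> 1\<close> F M in auto)
    ultimately show ?thesis unfolding \<rho>_def by simp
  qed
  have "degree q < s"
    unfolding q_def using \<open>s \<ge> 1\<close>
    by (intro degree_sum_less) (auto intro: le_less_trans[OF degree_monom_le])
  note exact = lagrange_exact[OF inj this, of \<theta>]
  have "F 0 (\<tau> + \<theta> * \<delta>) - (\<Sum>i=1..s. lagrange s c i \<theta> * F 0 (\<tau> + c i * \<delta>))
      = \<rho> \<theta> - (\<Sum>i=1..s. lagrange s c i \<theta> * \<rho> (c i))"
    using exact by (simp add: \<rho>_def right_diff_distrib sum_subtractf)
  also have "\<bar>\<dots>\<bar> \<le> \<bar>\<rho> \<theta>\<bar> + (\<Sum>i=1..s. \<bar>lagrange s c i \<theta> * \<rho> (c i)\<bar>)"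
    using sum_abs[of "\<lambda>i. lagrange s c i \<theta> * \<rho> (c i)" "{1..s}"] by linarith
  also have "\<dots> \<le> M * \<delta> ^ s + (\<Sum>i=1..s. \<bar>lagrange s c i \<theta>\<bar> * (M * \<delta> ^ s))"
    unfolding abs_mult using \<theta> c by (intro add_mono sum_mono mult_left_mono \<rho>) auto
  also have "\<dots> = M * \<delta> ^ s * (1 + (\<Sum>i=1..s. \<bar>lagrange s c i \<theta>\<bar>))"
    unfolding sum_distrib_right[symmetric] by (simp only: algebra_simps)
  finally show ?thesis .
qed

text \<open>The Lebesgue constant of the nodes on the unit interval, finite by compactness. It
  depends neither on the step length nor on the mesh.\<close>

lemma lagrange_bounded:
  obtains \<Lambda> where "0 \<le> \<Lambda>" "\<And>\<theta>. \<theta> \<in> {0..1} \<Longrightarrow> (\<Sum>i=1..s. \<bar>lagrange s c i \<theta>\<bar>) \<le> \<Lambda>"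
proof -
  have "continuous_on {0..1} (\<lambda>\<theta>. \<Sum>i=1..s. \<bar>lagrange s c i \<theta>\<bar>)"
    by (intro continuous_intros continuous_on_lagrange)
  then have "bounded ((\<lambda>\<theta>. \<Sum>i=1..s. \<bar>lagrange s c i \<theta>\<bar>) ` {0..1})"
    by (intro compact_imp_bounded compact_continuous_image) auto
  then obtain B where "\<And>\<theta>. \<theta> \<in> {0..1} \<Longrightarrow> norm (\<Sum>i=1..s. \<bar>lagrange s c i \<theta>\<bar>) \<le> B"
    unfolding bounded_iff by blast
  then have "\<And>\<theta>. \<theta> \<in> {0..1} \<Longrightarrow> (\<Sum>i=1..s. \<bar>lagrange s c i \<theta>\<bar>) \<le> \<bar>B\<bar>"
    unfolding real_norm_def by force
  then show thesis by (intro that[of "\<bar>B\<bar>"]) auto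
qed

section \<open>Bump functions\<close>

text \<open>The polynomial factor makes this class of functions closed under differentiation.\<close>

definition expinv :: "real poly \<Rightarrow> real \<Rightarrow> real" where
  "expinv p t = (if 0 < t then poly p (1 / t) * exp (- 1 / t) else 0)"

lemma poly_over_exp_at_top: "((\<lambda>y. poly p y / exp y) \<longlongrightarrow> 0) at_top" for p :: "real poly"
proof -
  have "((\<lambda>y. \<Sum>i\<le>degree p. coeff p i * (y ^ i / exp y)) \<longlongrightarrow> (\<Sum>i\<le>degree p. coeff p i * 0)) at_top"
    by (intro tendsto_intros tendsto_power_div_exp_0)
  then show ?thesis by (simp add: poly_altdef sum_divide_distrib)
qed

text \<open>With y = 1/t the derivative of p(y) exp(-y) is y^2 (p(y) - p'(y)) exp(-y), which
  explains the new polynomial. At 0 the function is constant to the left, and from the right the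
  exponential beats every polynomial in y.\<close>

lemma expinv_deriv:
  "(expinv p has_real_derivative expinv ([:0, 0, 1:] * (p - pderiv p)) t) (at t)"
proof -
  consider "t > 0" | "t < 0" | "t = 0" by linarith
  then show ?thesis
  proof cases
    case 1
    have "((\<lambda>t. poly p (1 / t) * exp (- 1 / t)) has_real_derivative
        expinv ([:0, 0, 1:] * (p - pderiv p)) t) (at t)"
      using 1
      by (auto intro!: derivative_eq_intros DERIV_chain2[where f = "poly p", OF poly_DERIV]
          simp: expinv_def field_simps power2_eq_square)
    then show ?thesis
      by (rule has_field_derivative_transform_within_open[where S = "{0<..}"]) (use 1 in \<open>auto simp: expinv_def\<close>)
  next
    case 2
    have "((\<lambda>t. 0) has_real_derivative expinv ([:0, 0, 1:] * (p - pderiv p)) t) (at t)"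
      using 2 by (simp add: expinv_def)
    then show ?thesis
      by (rule has_field_derivative_transform_within_open[where S = "{..<0}"]) (use 2 in \<open>auto simp: expinv_def\<close>)
  next
    case 3
    have "((\<lambda>h. expinv p h / h) \<longlongrightarrow> 0) (at_right 0)"
    proof (rule Lim_transform_eventually)
      \<comment> \<open>\<open>pCons 0 p\<close> stands for y p(y): the extra y = 1/h is the
        division in the difference quotient at 0.\<close>
      show "((\<lambda>h. poly (pCons 0 p) (inverse h) / exp (inverse h)) \<longlongrightarrow> 0) (at_right 0)"
        by (rule filterlim_compose[OF poly_over_exp_at_top filterlim_inverse_at_top_right])
      show "\<forall>\<^sub>F h in at_right 0. poly (pCons 0 p) (inverse h) / exp (inverse h) = expinv p h / h"
        using eventually_at_right_less[of 0]
        by eventually_elim (simp add: expinv_def exp_minus field_simps)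
    qed
    moreover have "((\<lambda>h. expinv p h / h) \<longlongrightarrow> 0) (at_left 0)"
      by (rule Lim_transform_eventually[OF tendsto_const])
         (auto simp: eventually_at_filter expinv_def)
    ultimately have "((\<lambda>h. expinv p h / h) \<longlongrightarrow> 0) (at 0)"
      by (simp add: filterlim_split_at)
    then show ?thesis by (simp add: DERIV_def 3 expinv_def)
  qed
qed

text \<open>Membership in \<open>test_functions\<close> asks for differentiability of all iterated
  partial derivatives. A class closed under partial derivatives reduces this to one
  differentiability proof and an induction over the list of directions.\<close>

inductive bump_expr :: "(real^'d \<Rightarrow> real) \<Rightarrow> bool" where
  const: "bump_expr (\<lambda>x. r)"
| expinv: "bump_expr (\<lambda>x. expinv p (\<alpha> * x $ i + \<beta>))"
| add: "bump_expr f \<Longrightarrow> bump_expr g \<Longrightarrow> bump_expr (\<lambda>x. f x + g x)"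
| mult: "bump_expr f \<Longrightarrow> bump_expr g \<Longrightarrow> bump_expr (\<lambda>x. f x * g x)"

lemma bump_expr_derivative:
  fixes f :: "real^'d \<Rightarrow> real"
  assumes "bump_expr f"
  shows "\<exists>f'. (\<forall>x. (f has_derivative f' x) (at x)) \<and> (\<forall>j. bump_expr (\<lambda>x. f' x (axis j 1)))"
  using assms
proof induction
  case (const r)
  then show ?case by (intro exI[of _ "\<lambda>x h. 0"]) (auto intro: bump_expr.const)
next
  case (expinv p \<alpha> i \<beta>)
  let ?q = "[:0, 0, 1:] * (p - pderiv p)"
  have "((\<lambda>x. expinv p (\<alpha> * x $ i + \<beta>)) has_derivative (\<lambda>h. expinv ?q (\<alpha> * x $ i + \<beta>) * (\<alpha> * h $ i))) (at x)" for x :: "real^'d"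
  proof -
    have "((\<lambda>x. \<alpha> * x $ i + \<beta>) has_derivative (\<lambda>h. \<alpha> * h $ i)) (at x)"
      by (auto intro!: derivative_eq_intros bounded_linear_imp_has_derivative bounded_linear_vec_nth)
    from has_derivative_compose[OF this expinv_deriv[of p "\<alpha> * x $ i + \<beta>", unfolded has_field_derivative_def]]
    show ?thesis by simp
  qed
  moreover have "bump_expr (\<lambda>x::real^'d. expinv ?q (\<alpha> * x $ i + \<beta>) * (\<alpha> * axis j 1 $ i))" for j
    by (intro bump_expr.mult bump_expr.const bump_expr.expinv)
  ultimately show ?case by (intro exI conjI allI)
next
  case (add f g)
  then obtain f' g' where "\<And>x. (f has_derivative f' x) (at x)" "\<And>x. (g has_derivative g' x) (at x)"
    "\<And>j. bump_expr (\<lambda>x. f' x (axis j 1))" "\<And>j. bump_expr (\<lambda>x. g' x (axis j 1))" by blast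
  then show ?case
    by (intro exI[of _ "\<lambda>x h. f' x h + g' x h"] conjI allI has_derivative_add bump_expr.add)
next
  case (mult f g)
  then obtain f' g' where "\<And>x. (f has_derivative f' x) (at x)" "\<And>x. (g has_derivative g' x) (at x)"
    "\<And>j. bump_expr (\<lambda>x. f' x (axis j 1))" "\<And>j. bump_expr (\<lambda>x. g' x (axis j 1))" by blast
  with mult.hyps show ?case
    by (intro exI[of _ "\<lambda>x h. f x * g' x h + f' x h * g x"] conjI allI has_derivative_mult
        bump_expr.add bump_expr.mult)
qed

lemma bump_expr_partials:
  fixes f :: "real^'d \<Rightarrow> real"
  assumes "bump_expr f"
  shows "bump_expr (partials is f)"
proof (induction "is")
  case (Cons i "is")
  then obtain f' where f': "\<And>x. (partials is f has_derivative f' x) (at x)" "bump_expr (\<lambda>x. f' x (axis i 1))"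
    using bump_expr_derivative by blast
  have "partials (i # is) f = (\<lambda>x. f' x (axis i 1))"
    using frechet_derivative_at[OF f'(1)] by (simp add: partial_def fun_eq_iff)
  with f'(2) show ?case by simp
qed (simp add: assms)

lemma bump_expr_prod: "(\<And>i. i \<in> I \<Longrightarrow> bump_expr (f i)) \<Longrightarrow> bump_expr (\<lambda>x. \<Prod>i\<in>I. f i x)"
  by (induction I rule: infinite_finite_induct) (auto intro: bump_expr.intros)

text \<open>The closed box is compact and contains the closure of the support, so both support
  conditions follow from it.\<close>

lemma bump_expr_test_function:
  assumes "bump_expr f" and supp: "\<And>x. f x \<noteq> 0 \<Longrightarrow> x \<in> cbox c d" and "cbox c d \<subseteq> \<Omega>"
  shows "f \<in> test_functions \<Omega>"
proof -
  have "partials is f differentiable_on UNIV" for "is"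
    using bump_expr_derivative[OF bump_expr_partials[OF assms(1)], of "is"]
    by (auto simp: differentiable_on_def differentiable_def)
  moreover have "closure {x. f x \<noteq> 0} \<subseteq> cbox c d"
    using supp by (intro closure_minimal) auto
  moreover from this have "compact (closure {x. f x \<noteq> 0})"
    using bounded_subset[OF bounded_cbox] by (simp add: compact_eq_bounded_closed)
  ultimately show ?thesis using assms(3) by (auto simp: test_functions_def)
qed

lemma tendsto_expinv_1: "((\<lambda>t. expinv [:1:] t) \<longlongrightarrow> 1) at_top"
proof (rule Lim_transform_eventually)
  have "((\<lambda>t. exp (- inverse t)) \<longlongrightarrow> exp (- 0 :: real)) at_top"
    by (intro tendsto_intros tendsto_inverse_0_at_top filterlim_ident)
  then show "((\<lambda>t. exp (- inverse t)) \<longlongrightarrow> (1::real)) at_top" by simp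
  show "\<forall>\<^sub>F t in at_top. exp (- inverse t) = expinv [:1:] t"
    using eventually_gt_at_top[of 0] by eventually_elim (simp add: expinv_def divide_inverse)
qed

lemma expinv_1_bounds: "0 \<le> expinv [:1:] t" "expinv [:1:] t \<le> 1" "expinv [:1:] t \<noteq> 0 \<longleftrightarrow> 0 < t"
  by (auto simp: expinv_def)

text \<open>Each coordinate contributes \<open>expinv\<close> at n(x - c) - 1 times
  \<open>expinv\<close> at n(d - x) - 1. The shift by 1 keeps the support in the closed box from c +
  1/n to d - 1/n, inside the open one; the factor n drives both arguments to infinity at interior
  points, where exp(-1/t) tends to 1.\<close>

lemma indicator_box_approx:
  fixes c d :: "real^'d"
  assumes "box c d \<subseteq> \<Omega>"
  obtains \<phi> :: "nat \<Rightarrow> real^'d \<Rightarrow> real" where "\<And>n. \<phi> n \<in> test_functions \<Omega>" "\<And>n x. \<bar>\<phi> n x\<bar> \<le> 1"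
    "\<And>n. \<phi> n \<in> borel_measurable borel" "\<And>x. (\<lambda>n. \<phi> n x) \<longlonglongrightarrow> indicator (box c d) x"
proof -
  define \<psi> where "\<psi> n x i = expinv [:1:] (real n * x $ i + (- real n * c $ i - 1)) *
      expinv [:1:] (- real n * x $ i + (real n * d $ i - 1))" for n and x :: "real^'d" and i
  define \<phi> where "\<phi> n x = (\<Prod>i\<in>UNIV. \<psi> n x i)" for n x
  have \<psi>01: "0 \<le> \<psi> n x i" "\<psi> n x i \<le> 1" for n x i
    unfolding \<psi>_def using expinv_1_bounds by (auto intro!: mult_le_one)
  have bump: "bump_expr (\<phi> n)" for n
    unfolding \<phi>_def[abs_def] \<psi>_def by (intro bump_expr_prod bump_expr.intros)
  have pos: "1 \<le> real n * (x $ i - c $ i) \<and> 1 \<le> real n * (d $ i - x $ i)" if "\<phi> n x \<noteq> 0" for n x i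
    using that expinv_1_bounds(3) by (auto simp: \<phi>_def \<psi>_def algebra_simps less_eq_real_def)
  have "\<phi> n \<in> test_functions \<Omega>" for n
  \<comment> \<open>For n = 0 every argument of \<open>expinv\<close> is -1, so the function
    vanishes, and the empty closed box from 1 to 0 encloses its support.\<close>
  proof (cases "n = 0")
    case True
    then have "\<phi> n x = 0" for x using pos[of n x] by fastforce
    then show ?thesis
      by (intro bump_expr_test_function[OF bump, of n 1 0]) (use \<open>\<And>x. \<phi> n x = 0\<close> interval_eq_empty_cart(2)[of 1 "0 :: real^'d"] in auto)
  next
    case False
    show ?thesis
    proof (rule bump_expr_test_function[OF bump])
      show "x \<in> cbox (\<chi> i. c $ i + 1 / real n) (\<chi> i. d $ i - 1 / real n)" if "\<phi> n x \<noteq> 0" for x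
        using pos[OF that] False by (auto simp: mem_box_cart field_simps)
      have "cbox (\<chi> i. c $ i + 1 / real n) (\<chi> i. d $ i - 1 / real n) \<subseteq> box c d"
      proof
        fix x assume x: "x \<in> cbox (\<chi> i. c $ i + 1 / real n) (\<chi> i. d $ i - 1 / real n)"
        have "0 < 1 / real n" using False by simp
        moreover have "c $ i + 1 / real n \<le> x $ i \<and> x $ i \<le> d $ i - 1 / real n" for i
          using x by (simp add: mem_box_cart)
        ultimately have "c $ i < x $ i \<and> x $ i < d $ i" for i
          by (smt (verit))
        then show "x \<in> box c d" by (simp add: mem_box_cart)
      qed
      with assms show "cbox (\<chi> i. c $ i + 1 / real n) (\<chi> i. d $ i - 1 / real n) \<subseteq> \<Omega>" by blast
    qed
  qed
  moreover have "\<bar>\<phi> n x\<bar> \<le> 1" for n x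
    unfolding \<phi>_def using \<psi>01 by (auto simp: abs_prod intro!: prod_le_1)
  moreover have "\<phi> n \<in> borel_measurable borel" for n
  proof -
    have "\<phi> n differentiable_on UNIV"
      using bump_expr_derivative[OF bump, of n] by (auto simp: differentiable_on_def differentiable_def)
    then show ?thesis
      by (intro borel_measurable_continuous_onI differentiable_imp_continuous_on)
  qed
  moreover have "(\<lambda>n. \<phi> n x) \<longlonglongrightarrow> indicator (box c d) x" for x
  proof (cases "x \<in> box c d")
    case True
    have lim: "(\<lambda>n. expinv [:1:] (real n * r - 1)) \<longlonglongrightarrow> 1" if "0 < r" for r
    proof (rule filterlim_compose[OF tendsto_expinv_1])
      have "filterlim (\<lambda>n. - 1 + r * real n) at_top sequentially"
        by (intro filterlim_tendsto_add_at_top[OF tendsto_const]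
            filterlim_tendsto_pos_mult_at_top[OF tendsto_const that] filterlim_real_sequentially)
      then show "filterlim (\<lambda>n. real n * r - 1) at_top sequentially" by (simp add: mult.commute)
    qed
    have "(\<lambda>n. \<psi> n x i) \<longlonglongrightarrow> 1 * 1" for i
    proof -
      have eq: "\<psi> n x i = expinv [:1:] (real n * (x $ i - c $ i) - 1) * expinv [:1:] (real n * (d $ i - x $ i) - 1)" for n
        by (simp add: \<psi>_def algebra_simps)
      show ?thesis unfolding eq using True by (intro tendsto_mult lim) (auto simp: mem_box_cart)
    qed
    then have "(\<lambda>n. \<Prod>i\<in>UNIV. \<psi> n x i) \<longlonglongrightarrow> (\<Prod>i\<in>(UNIV :: 'd set). 1 * 1)"
      by (rule tendsto_prod)
    then have "(\<lambda>n. \<phi> n x) \<longlonglongrightarrow> 1"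
      by (simp add: \<phi>_def)
    then show ?thesis using True by simp
  next
    case False
    have "\<phi> n x = 0" for n
    proof (rule ccontr)
      assume "\<phi> n x \<noteq> 0"
      have "c $ i < x $ i \<and> x $ i < d $ i" for i
      proof -
        have *: "0 < r" if "1 \<le> real n * r" for r using that
          by (metis mult_nonneg_nonpos not_le of_nat_0_le_iff order_trans zero_less_one)
        show ?thesis using *[of "x $ i - c $ i"] *[of "d $ i - x $ i"] pos[OF \<open>\<phi> n x \<noteq> 0\<close>, of i] by simp
      qed
      with False show False by (simp add: mem_box_cart)
    qed
    with False show ?thesis by simp
  qed
  ultimately show thesis by (rule that)
qed

section \<open>The space \<open>L\<^sup>2\<close> and uniqueness of weak derivatives\<close>

lemma L2_mult_integrable:
  assumes "v \<in> L2 \<Omega>" "w \<in> L2 \<Omega>"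
  shows "integrable (lebesgue_on \<Omega>) (\<lambda>x. v x * w x)"
proof (rule Bochner_Integration.integrable_bound)
  show "integrable (lebesgue_on \<Omega>) (\<lambda>x. (v x)\<^sup>2 + (w x)\<^sup>2)"
    using assms by (auto simp: L2_def)
  show "(\<lambda>x. v x * w x) \<in> borel_measurable (lebesgue_on \<Omega>)"
    using assms by (auto simp: L2_def)
  have "\<bar>r * t\<bar> \<le> \<bar>r\<^sup>2 + t\<^sup>2\<bar>" for r t :: real
  proof -
    have "2 * (\<bar>r\<bar> * \<bar>t\<bar>) \<le> r\<^sup>2 + t\<^sup>2" "0 \<le> \<bar>r\<bar> * \<bar>t\<bar>" using sum_squares_bound[of "\<bar>r\<bar>" "\<bar>t\<bar>"] by simp_all
    then show ?thesis unfolding abs_mult by linarith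
  qed
  then show "AE x in lebesgue_on \<Omega>. norm (v x * w x) \<le> norm ((v x)\<^sup>2 + (w x)\<^sup>2)" by simp
qed

lemma L2_zero [simp]: "(\<lambda>x. 0) \<in> L2 \<Omega>"
  by (simp add: L2_def)

lemma L2_add:
  assumes "v \<in> L2 \<Omega>" "w \<in> L2 \<Omega>"
  shows "(\<lambda>x. v x + w x) \<in> L2 \<Omega>"
proof -
  have "integrable (lebesgue_on \<Omega>) (\<lambda>x. (v x)\<^sup>2 + (w x)\<^sup>2 + 2 * (v x * w x))"
    using assms L2_mult_integrable[OF assms] by (intro Bochner_Integration.integrable_add) (auto simp: L2_def)
  moreover have "(\<lambda>x. v x + w x) \<in> borel_measurable (lebesgue_on \<Omega>)"
    using assms by (intro borel_measurable_add) (auto simp: L2_def)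
  ultimately show ?thesis by (simp add: L2_def power2_sum mult.assoc)
qed

lemma L2_cmult: "v \<in> L2 \<Omega> \<Longrightarrow> (\<lambda>x. r * v x) \<in> L2 \<Omega>"
  by (auto simp: L2_def power_mult_distrib)

lemma L2_diff: "v \<in> L2 \<Omega> \<Longrightarrow> w \<in> L2 \<Omega> \<Longrightarrow> (\<lambda>x. v x - w x) \<in> L2 \<Omega>"
  using L2_add[of v \<Omega> "\<lambda>x. - 1 * w x"] L2_cmult[of w \<Omega> "- 1"] by simp

lemma L2_sum: "(\<And>k. k \<in> K \<Longrightarrow> v k \<in> L2 \<Omega>) \<Longrightarrow> (\<lambda>x. \<Sum>k\<in>K. \<gamma> k * v k x) \<in> L2 \<Omega>"
proof (induction K rule: infinite_finite_induct)
  case (insert k K)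
  then have "(\<lambda>x. \<gamma> k * v k x + (\<Sum>k\<in>K. \<gamma> k * v k x)) \<in> L2 \<Omega>"
    by (intro L2_add L2_cmult) auto
  with insert show ?case by simp
qed simp_all

lemma L2_bounded:
  assumes "v \<in> borel_measurable (lebesgue_on \<Omega>)" "\<And>x. x \<in> \<Omega> \<Longrightarrow> \<bar>v x\<bar> \<le> B" "\<Omega> \<in> lmeasurable"
  shows "v \<in> L2 \<Omega>"
proof -
  interpret finite_measure "lebesgue_on \<Omega>" by (rule finite_measure_lebesgue_on[OF assms(3)])
  have "integrable (lebesgue_on \<Omega>) (\<lambda>x. (v x)\<^sup>2)"
  proof (rule integrable_const_bound)
    show "AE x in lebesgue_on \<Omega>. norm ((v x)\<^sup>2) \<le> B\<^sup>2"
    proof (rule AE_I2)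
      fix x assume "x \<in> space (lebesgue_on \<Omega>)"
      then have "\<bar>v x\<bar> \<le> \<bar>B\<bar>" using assms(2)[of x] by simp
      then show "norm ((v x)\<^sup>2) \<le> B\<^sup>2" by (simp add: abs_le_square_iff)
    qed
  qed (use assms(1) in simp)
  with assms(1) show ?thesis by (simp add: L2_def)
qed

lemma l2_inner_commute: "l2_inner \<Omega> v w = l2_inner \<Omega> w v"
  by (simp add: l2_inner_def mult.commute)

lemma l2_inner_add_left:
  "v \<in> L2 \<Omega> \<Longrightarrow> v' \<in> L2 \<Omega> \<Longrightarrow> w \<in> L2 \<Omega> \<Longrightarrow>
    l2_inner \<Omega> (\<lambda>x. v x + v' x) w = l2_inner \<Omega> v w + l2_inner \<Omega> v' w"
  unfolding l2_inner_def distrib_right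
  by (intro Bochner_Integration.integral_add L2_mult_integrable)

lemma l2_inner_diff_left:
  "v \<in> L2 \<Omega> \<Longrightarrow> v' \<in> L2 \<Omega> \<Longrightarrow> w \<in> L2 \<Omega> \<Longrightarrow>
    l2_inner \<Omega> (\<lambda>x. v x - v' x) w = l2_inner \<Omega> v w - l2_inner \<Omega> v' w"
  unfolding l2_inner_def left_diff_distrib
  by (intro Bochner_Integration.integral_diff L2_mult_integrable)

lemma l2_inner_cmult_left: "l2_inner \<Omega> (\<lambda>x. r * v x) w = r * l2_inner \<Omega> v w"
  by (simp add: l2_inner_def mult.assoc)

lemma l2_inner_sum_left:
  assumes "\<And>k. k \<in> K \<Longrightarrow> v k \<in> L2 \<Omega>" "w \<in> L2 \<Omega>"
  shows "l2_inner \<Omega> (\<lambda>x. \<Sum>k\<in>K. \<gamma> k * v k x) w = (\<Sum>k\<in>K. \<gamma> k * l2_inner \<Omega> (v k) w)"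
  using assms(1)
proof (induction K rule: infinite_finite_induct)
  case (insert k K)
  have "l2_inner \<Omega> (\<lambda>x. \<gamma> k * v k x + (\<Sum>k\<in>K. \<gamma> k * v k x)) w
      = l2_inner \<Omega> (\<lambda>x. \<gamma> k * v k x) w + l2_inner \<Omega> (\<lambda>x. \<Sum>k\<in>K. \<gamma> k * v k x) w"
    using insert.prems assms(2) by (intro l2_inner_add_left L2_sum L2_cmult) auto
  with insert show ?case by (simp add: l2_inner_cmult_left)
qed (simp_all add: l2_inner_def)

lemma l2_inner_nonneg: "0 \<le> l2_inner \<Omega> v v"
  by (simp add: l2_inner_def integral_nonneg_AE)

lemma l2_norm_power2: "(l2_norm \<Omega> v)\<^sup>2 = l2_inner \<Omega> v v"
  by (simp add: l2_norm_def l2_inner_nonneg)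

lemma l2_inner_eq_0D:
  assumes "v \<in> L2 \<Omega>" "l2_inner \<Omega> v v = 0"
  shows "AE x in lebesgue_on \<Omega>. v x = 0"
proof -
  have "AE x in lebesgue_on \<Omega>. v x * v x = 0"
    using assms L2_mult_integrable[OF assms(1) assms(1)]
    by (subst integral_nonneg_eq_0_iff_AE[symmetric]) (simp_all add: l2_inner_def)
  then show ?thesis by simp
qed

lemma L2_imp_integrable:
  assumes "v \<in> L2 \<Omega>" "\<Omega> \<in> lmeasurable"
  shows "integrable (lebesgue_on \<Omega>) v"
proof -
  interpret finite_measure "lebesgue_on \<Omega>" by (rule finite_measure_lebesgue_on[OF assms(2)])
  have "(\<lambda>x. 1) \<in> L2 \<Omega>" using assms(2) by (intro L2_bounded[of _ _ 1]) auto
  from L2_mult_integrable[OF assms(1) this] show ?thesis by simp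
qed

text \<open>Boxes are an intersection-stable generator of the Borel sets, so vanishing integrals
  spread from boxes to all Borel sets by Dynkin induction, in particular to the sets where the
  function is positive or negative.\<close>

lemma AE_eq_0_if_integral_box_eq_0:
  fixes g :: "'a::euclidean_space \<Rightarrow> real"
  assumes g: "integrable lebesgue g"
    and box: "\<And>c d. (\<integral>x. indicator (box c d) x * g x \<partial>lebesgue) = 0"
    and total: "integral\<^sup>L lebesgue g = 0"
  shows "AE x in lebesgue. g x = 0"
proof -
  \<comment> \<open>The induction runs over Borel sets and \<open>lborel\<close>, so the Lebesgue
    measurable function is exchanged for a Borel function equal to it almost everywhere.\<close>
  obtain g' where g'[measurable]: "g' \<in> borel_measurable lborel" and ae: "AE x in lborel. g x = g' x"
    using completion_ex_borel_measurable_real[of g lborel] borel_measurable_integrable[OF g] by auto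
  have aeL: "AE x in lebesgue. g x = g' x"
    using AE_completion[OF ae] .
  have int': "integrable lebesgue g'"
    using g aeL by (subst integrable_cong_AE[of _ _ g]) (auto intro: measurable_completion g')
  then have int[simp]: "integrable lborel g'"
    by (simp add: integrable_completion g')
  have eq: "(LINT x:A|lborel. g' x) = (\<integral>x. indicator A x * g x \<partial>lebesgue)" if [measurable]: "A \<in> sets borel" for A
  proof -
    have "(LINT x:A|lborel. g' x) = (\<integral>x. indicator A x * g' x \<partial>lebesgue)"
      unfolding set_lebesgue_integral_def real_scaleR_def
      by (rule integral_completion[symmetric]) measurable
    also have "\<dots> = (\<integral>x. indicator A x * g x \<partial>lebesgue)"
      using aeL borel_measurable_integrable[OF g] borel_measurable_integrable[OF int']
      by (intro integral_cong_AE borel_measurable_times borel_measurable_indicator) auto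
    finally show ?thesis .
  qed
  have zero: "(LINT x:A|lborel. g' x) = 0" if "A \<in> sets borel" for A
  proof -
    have "Int_stable (range (\<lambda>(c, d). box c d :: 'a set))"
      by (auto simp: Int_stable_def box_Int_box)
    moreover have "range (\<lambda>(c, d). box c d :: 'a set) \<subseteq> Pow UNIV" by simp
    moreover have "A \<in> sigma_sets UNIV (range (\<lambda>(c, d). box c d))"
      using that unfolding borel_eq_box by simp
    ultimately show ?thesis
    proof (induction rule: sigma_sets_induct_disjoint)
      case (basic A)
      then show ?case using box by (auto simp: eq)
    next
      case empty
      show ?case by (simp add: set_lebesgue_integral_def)
    next
      \<comment> \<open>Complements are reached by subtraction from the whole space. As the whole
        space is not a box, its integral has to be supplied by \<open>total\<close>.\<close>
      case (compl A)
      then have [measurable]: "A \<in> sets borel" by (simp add: borel_eq_box)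
      have "set_integrable lborel S g'" if "S \<in> sets borel" for S
        using integrable_mult_indicator[OF _ int, of S] that by (simp add: set_integrable_def)
      then have "(LINT x:A \<union> (UNIV - A)|lborel. g' x) = (LINT x:A|lborel. g' x) + (LINT x:(UNIV - A)|lborel. g' x)"
        by (intro set_integral_Un) auto
      moreover have "A \<union> (UNIV - A) = UNIV" by auto
      moreover have "(LINT x:UNIV|lborel. g' x) = 0" using total by (simp add: eq)
      ultimately show ?case using compl by simp
    next
      case (union F)
      then have [measurable]: "\<And>i. F i \<in> sets borel" by (simp add: borel_eq_box subset_eq)
      have "set_integrable lborel (\<Union>i. F i) g'"
        using integrable_mult_indicator[OF _ int, of "\<Union>i. F i"] by (simp add: set_integrable_def)
      then have "(LINT x:(\<Union>i. F i)|lborel. g' x) = (\<Sum>i. LINT x:(F i)|lborel. g' x)"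
        using union.hyps by (intro lebesgue_integral_countable_add) (auto simp: disjoint_family_on_def)
      then show ?case using union by simp
    qed
  qed
  \<comment> \<open>Taking \<open>g'\<close> and its negative for \<open>h\<close> treats the
    positive and the negative part by one argument.\<close>
  have pos: "AE x in lborel. indicator A x * h x = 0"
    if h: "h = g' \<or> h = (\<lambda>x. - g' x)" and A: "A = {x. 0 < h x}" for A h
  proof -
    have [measurable]: "h \<in> borel_measurable borel" using h g' by auto
    have [measurable]: "A \<in> sets borel" unfolding A by measurable
    have "integrable lborel h" using h int by auto
    then have "integrable lborel (\<lambda>x. indicator A x * h x)"
      using integrable_mult_indicator[of A lborel h] by simp
    moreover have "(\<integral>x. indicator A x * h x \<partial>lborel) = 0"
      using h zero[of A] by (auto simp: set_lebesgue_integral_def)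
    ultimately show ?thesis
      by (subst integral_nonneg_eq_0_iff_AE[symmetric]) (auto simp: A indicator_def)
  qed
  have "AE x in lborel. g' x = 0"
    using pos[OF disjI1[OF refl] refl] pos[OF disjI2[OF refl] refl]
    by eventually_elim (auto simp: indicator_def split: if_splits)
  then have "AE x in lebesgue. g' x = 0" by (rule AE_completion)
  with aeL show ?thesis by eventually_elim simp
qed

text \<open>Test functions approach the indicator of a subbox pointwise and boundedly, so dominated
  convergence with majorant |g| carries the hypothesis over to indicators. The conclusion is then
  drawn for \<open>?G\<close>, the extension of g by zero.\<close>

lemma fundamental_lemma_box:
  fixes a b :: "real^'d"
  assumes g: "g \<in> L2 (box a b)" and test: "\<And>\<phi>. \<phi> \<in> test_functions (box a b) \<Longrightarrow> l2_inner (box a b) g \<phi> = 0"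
  shows "AE x in lebesgue_on (box a b). g x = 0"
proof -
  let ?\<Omega> = "box a b"
  let ?G = "\<lambda>x. indicator ?\<Omega> x * g x"
  have g_int: "integrable (lebesgue_on ?\<Omega>) g"
    by (rule L2_imp_integrable[OF g]) simp
  have sub: "(\<integral>x. indicator (box c d) x * g x \<partial>lebesgue_on ?\<Omega>) = 0" if sub: "box c d \<subseteq> ?\<Omega>" for c d
  proof -
    obtain \<phi> :: "nat \<Rightarrow> real^'d \<Rightarrow> real" where \<phi>: "\<And>n. \<phi> n \<in> test_functions ?\<Omega>" "\<And>n x. \<bar>\<phi> n x\<bar> \<le> 1"
      "\<And>n. \<phi> n \<in> borel_measurable borel" "\<And>x. (\<lambda>n. \<phi> n x) \<longlonglongrightarrow> indicator (box c d) x"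
      using indicator_box_approx[OF sub] by blast
    have \<phi>_meas: "\<phi> n \<in> borel_measurable (lebesgue_on ?\<Omega>)" for n
      using \<phi>(3) by (intro measurable_restrict_space1 measurable_completion) simp
    have "(\<lambda>n. \<integral>x. \<phi> n x * g x \<partial>lebesgue_on ?\<Omega>) \<longlonglongrightarrow> (\<integral>x. indicator (box c d) x * g x \<partial>lebesgue_on ?\<Omega>)"
    proof (rule integral_dominated_convergence[where w = "\<lambda>x. \<bar>g x\<bar>"])
      show "integrable (lebesgue_on ?\<Omega>) (\<lambda>x. \<bar>g x\<bar>)" using g_int by simp
      show "AE x in lebesgue_on ?\<Omega>. norm (\<phi> n x * g x) \<le> \<bar>g x\<bar>" for n
        using \<phi>(2) by (intro AE_I2) (simp add: abs_mult mult_left_le_one_le)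
      show "AE x in lebesgue_on ?\<Omega>. (\<lambda>n. \<phi> n x * g x) \<longlonglongrightarrow> indicator (box c d) x * g x"
        using \<phi>(4) by (intro AE_I2 tendsto_mult_right)
      show "(\<lambda>x. indicator (box c d) x * g x) \<in> borel_measurable (lebesgue_on ?\<Omega>)"
        using borel_measurable_integrable[OF g_int]
        by (intro borel_measurable_times borel_measurable_indicator) (use sub in \<open>auto simp: sets_restrict_space intro!: image_eqI[of _ _ "box c d"]\<close>)
    qed (use \<phi>_meas borel_measurable_integrable[OF g_int] in auto)
    moreover have "(\<integral>x. \<phi> n x * g x \<partial>lebesgue_on ?\<Omega>) = 0" for n
      using test[OF \<phi>(1)] by (simp add: l2_inner_def mult.commute)
    ultimately show ?thesis by (simp add: LIMSEQ_const_iff)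
  qed
  have rs: "(\<integral>x. h x \<partial>lebesgue_on ?\<Omega>) = (\<integral>x. indicator ?\<Omega> x * h x \<partial>lebesgue)" for h :: "real^'d \<Rightarrow> real"
    by (subst integral_restrict_space) auto
  have "AE x in lebesgue. ?G x = 0"
  proof (rule AE_eq_0_if_integral_box_eq_0)
    show "integrable lebesgue ?G"
      using g_int by (subst (asm) integrable_restrict_space) auto
    show "(\<integral>x. indicator (box c d) x * ?G x \<partial>lebesgue) = 0" for c d
    proof -
      \<comment> \<open>Intersections of boxes are boxes, so an arbitrary box reduces to one inside
        the domain.\<close>
      obtain c' d' where cd: "box c d \<inter> ?\<Omega> = box c' d'"
        using box_Int_box[of c d a b] by blast
      have "(\<lambda>x. indicator (box c d) x * ?G x) = (\<lambda>x. indicator ?\<Omega> x * (indicator (box c' d') x * g x))"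
        unfolding cd[symmetric] by (auto simp: indicator_def fun_eq_iff)
      with sub[of c' d'] show ?thesis unfolding rs using cd by auto
    qed
    have "(\<lambda>x. indicator ?\<Omega> x * (indicator ?\<Omega> x * g x)) = ?G"
      by (auto simp: indicator_def)
    then show "integral\<^sup>L lebesgue ?G = 0" using sub[of a b] unfolding rs by simp
  qed
  then show ?thesis
    by (subst AE_restrict_space_iff) (auto simp: indicator_def elim!: eventually_mono)
qed

lemma test_function_L2:
  assumes "\<phi> \<in> test_functions \<Omega>" "\<Omega> \<in> lmeasurable"
  shows "\<phi> \<in> L2 \<Omega>"
proof -
  have d: "\<forall>is. partials is \<phi> differentiable_on UNIV" and K: "compact (closure {x. \<phi> x \<noteq> 0})"
    using assms(1) by (simp_all add: test_functions_def)
  from d[THEN spec, of "[]"] have cont: "continuous_on UNIV \<phi>"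
    by (simp add: differentiable_imp_continuous_on)
  have "bounded (\<phi> ` closure {x. \<phi> x \<noteq> 0})"
    by (rule compact_imp_bounded[OF compact_continuous_image[OF continuous_on_subset[OF cont subset_UNIV] K]])
  then obtain B where B: "\<forall>y\<in>\<phi> ` closure {x. \<phi> x \<noteq> 0}. norm y \<le> B"
    unfolding bounded_iff by (elim exE)
  have bound: "\<bar>\<phi> x\<bar> \<le> \<bar>B\<bar>" for x
  proof (cases "\<phi> x = 0")
    case False
    then have "x \<in> closure {x. \<phi> x \<noteq> 0}" by (intro subsetD[OF closure_subset]) simp
    then have "norm (\<phi> x) \<le> B" using B by blast
    then show ?thesis by simp
  qed simp
  have "\<phi> \<in> borel_measurable (lebesgue_on \<Omega>)"
    by (intro measurable_restrict_space1 measurable_completion) (use cont in \<open>simp add: borel_measurable_continuous_onI\<close>)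
  then show ?thesis by (rule L2_bounded[OF _ bound assms(2)])
qed

text \<open>The sign cancels, so the difference of two candidates pairs to zero with every test
  function; a single list enumerating \<alpha> suffices for this.\<close>

lemma weak_deriv_unique:
  fixes a b :: "real^'d"
  assumes "has_weak_deriv (box a b) \<alpha> v g" "has_weak_deriv (box a b) \<alpha> v g'"
  shows "AE x in lebesgue_on (box a b). g x = g' x"
proof -
  have L2: "g \<in> L2 (box a b)" "g' \<in> L2 (box a b)"
    using assms by (auto simp: has_weak_deriv_def)
  obtain "is" where "is": "mset is = \<alpha>" using ex_mset by blast
  have "AE x in lebesgue_on (box a b). g x - g' x = 0"
  proof (rule fundamental_lemma_box)
    fix \<phi> assume \<phi>: "\<phi> \<in> test_functions (box a b)"
    have weak: "l2_inner (box a b) v (partials is \<phi>) = (- 1) ^ size \<alpha> * l2_inner (box a b) h \<phi>"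
      if "has_weak_deriv (box a b) \<alpha> v h" for h
      using that \<phi> "is" unfolding has_weak_deriv_def by blast
    have "(- 1) ^ size \<alpha> * l2_inner (box a b) g \<phi> = (- 1) ^ size \<alpha> * l2_inner (box a b) g' \<phi>"
      using weak[OF assms(1)] weak[OF assms(2)] by (rule trans[OF sym])
    then show "l2_inner (box a b) (\<lambda>x. g x - g' x) \<phi> = 0"
      using test_function_L2[OF \<phi>] L2 by (simp add: l2_inner_diff_left)
  qed (rule L2_diff[OF L2])
  then show ?thesis by simp
qed

text \<open>Makes the choice by \<open>SOME\<close> harmless: under integrals, a concretely
  constructed weak derivative may replace it.\<close>

lemma weak_deriv_eq:
  fixes a b :: "real^'d"
  assumes "has_weak_deriv (box a b) \<alpha> v g"
  shows "weak_deriv (box a b) \<alpha> v \<in> L2 (box a b)" "AE x in lebesgue_on (box a b). weak_deriv (box a b) \<alpha> v x = g x"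
proof -
  have *: "has_weak_deriv (box a b) \<alpha> v (weak_deriv (box a b) \<alpha> v)"
    unfolding weak_deriv_def using assms by (rule someI[where P = "has_weak_deriv (box a b) \<alpha> v"])
  then show "weak_deriv (box a b) \<alpha> v \<in> L2 (box a b)" by (simp add: has_weak_deriv_def)
  show "AE x in lebesgue_on (box a b). weak_deriv (box a b) \<alpha> v x = g x"
    using weak_deriv_unique[OF * assms] .
qed

section \<open>Weak derivatives of piecewise linear functions\<close>

lemma integrable_continuous_support:
  fixes f :: "'a::euclidean_space \<Rightarrow> real"
  assumes "continuous_on UNIV f" "\<And>x. x \<notin> cbox a b \<Longrightarrow> f x = 0"
  shows "integrable lborel f"
proof -
  have "integrable lborel (\<lambda>x. indicator (cbox a b) x *\<^sub>R f x)"
    by (intro borel_integrable_compact continuous_on_subset[OF assms(1)]) auto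
  moreover have "(\<lambda>x. indicator (cbox a b) x *\<^sub>R f x) = f"
    using assms(2) by (auto simp: indicator_def fun_eq_iff)
  ultimately show ?thesis by simp
qed

lemma lborel_integral_translation:
  fixes f :: "'a::euclidean_space \<Rightarrow> real"
  assumes "f \<in> borel_measurable borel"
  shows "(\<integral>x. f (c + x) \<partial>lborel) = integral\<^sup>L lborel f"
  using integral_distr[of "(+) c" lborel borel f] assms by (simp add: lborel_distr_plus)

lemma l2_inner_lborel:
  fixes \<Omega> :: "(real^'d) set"
  assumes "\<Omega> \<in> sets borel" "(\<lambda>x. v x * w x) \<in> borel_measurable borel" "\<And>x. x \<notin> \<Omega> \<Longrightarrow> v x * w x = 0"
  shows "l2_inner \<Omega> v w = (\<integral>x. v x * w x \<partial>lborel)"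
proof -
  have "l2_inner \<Omega> v w = (\<integral>x. indicator \<Omega> x * (v x * w x) \<partial>lebesgue)"
    unfolding l2_inner_def using assms(1) by (subst integral_restrict_space) auto
  also have "(\<lambda>x. indicator \<Omega> x * (v x * w x)) = (\<lambda>x. v x * w x)"
    using assms(3) by (auto simp: indicator_def fun_eq_iff)
  also have "(\<integral>x. v x * w x \<partial>lebesgue) = (\<integral>x. v x * w x \<partial>lborel)"
    by (rule integral_completion) (use assms(2) in simp)
  finally show ?thesis .
qed

lemma continuous_imp_lebesgue_on_measurable:
  fixes v :: "'a::euclidean_space \<Rightarrow> real"
  shows "v \<in> borel_measurable borel \<Longrightarrow> v \<in> borel_measurable (lebesgue_on \<Omega>)"
  by (intro measurable_restrict_space1 measurable_completion) simp

text \<open>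
  Summation by parts for difference quotients, passed to the limit. One-sided quotients suffice, so
  a piecewise linear \<open>v\<close> has a limit \<open>g\<close> everywhere, also on the faces of the mesh.
\<close>

lemma has_weak_deriv_difference_quotient:
  fixes v g :: "real^'d \<Rightarrow> real" and a b :: "real^'d"
  assumes cont: "continuous_on UNIV v" and zero: "\<And>x. x \<notin> box a b \<Longrightarrow> v x = 0"
    and lip: "\<And>x h. 0 < h \<Longrightarrow> \<bar>v x - v (x - h *\<^sub>R axis j 1)\<bar> \<le> K * h"
    and lim: "\<And>x. (\<lambda>n. (v x - v (x - (1 / real (Suc n)) *\<^sub>R axis j 1)) / (1 / real (Suc n))) \<longlonglongrightarrow> g x"
  shows "has_weak_deriv (box a b) {#j#} v g"
proof -
  let ?e = "axis j 1 :: real^'d"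
  let ?h = "\<lambda>n. 1 / real (Suc n)"
  let ?q = "\<lambda>n x. (v x - v (x - ?h n *\<^sub>R ?e)) / ?h n"
  have q_cont: "continuous_on UNIV (?q n)" for n
    by (intro continuous_intros continuous_on_compose2[OF cont]) auto
  have zero': "v x = 0" if "x \<notin> cbox a b" for x
    using that zero[of x] box_subset_cbox[of a b] by blast
  have v_meas: "v \<in> borel_measurable borel" by (rule borel_measurable_continuous_onI[OF cont])
  have g_meas: "g \<in> borel_measurable borel"
    by (rule borel_measurable_LIMSEQ_real[OF lim borel_measurable_continuous_onI[OF q_cont]])
  have q_bound: "\<bar>?q n x\<bar> \<le> K" for n x
  proof -
    have *: "\<bar>r / h\<bar> \<le> K" if "0 < h" "\<bar>r\<bar> \<le> K * h" for r h :: real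
      using that by (simp add: pos_divide_le_eq)
    show ?thesis by (rule *[OF _ lip]) simp_all
  qed
  have g_bound: "\<bar>g x\<bar> \<le> K" for x
    using q_bound by (intro Lim_bounded[OF tendsto_rabs[OF lim]]) auto
  have v_bound: "bounded (v ` cbox a b)"
    by (rule compact_imp_bounded[OF compact_continuous_image[OF continuous_on_subset[OF cont subset_UNIV] compact_cbox]])
  then obtain Bv where Bv: "\<forall>y\<in>v ` cbox a b. norm y \<le> Bv"
    unfolding bounded_iff by (elim exE)
  have "v \<in> L2 (box a b)"
  proof (rule L2_bounded[OF continuous_imp_lebesgue_on_measurable[OF v_meas]])
    show "\<bar>v x\<bar> \<le> Bv" if "x \<in> box a b" for x
      using Bv that box_subset_cbox[of a b] by fastforce
  qed simp
  moreover have "g \<in> L2 (box a b)"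
    by (rule L2_bounded[OF continuous_imp_lebesgue_on_measurable[OF g_meas] g_bound]) simp
  moreover have "l2_inner (box a b) v (partials [j] \<phi>) = - l2_inner (box a b) g \<phi>"
    if \<phi>: "\<phi> \<in> test_functions (box a b)" for \<phi>
  proof -
    define \<psi> where "\<psi> = partial j \<phi>"
    have d: "\<forall>is. partials is \<phi> differentiable_on UNIV" and supp: "closure {x. \<phi> x \<noteq> 0} \<subseteq> box a b"
      using \<phi> by (simp_all add: test_functions_def)
    have \<phi>_diff: "\<phi> differentiable (at x)" for x
      using d[THEN spec, of "[]"] by (simp add: differentiable_on_def)
    have \<phi>_cont: "continuous_on UNIV \<phi>"
      using d[THEN spec, of "[]"] by (simp add: differentiable_imp_continuous_on)
    have \<psi>_cont: "continuous_on UNIV \<psi>"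
      using d[THEN spec, of "[j]"] by (simp add: \<psi>_def differentiable_imp_continuous_on)
    have \<phi>_zero: "\<phi> x = 0" if "x \<notin> box a b" for x
      using that supp closure_subset[of "{x. \<phi> x \<noteq> 0}"] by (meson mem_Collect_eq subsetD)
    have \<phi>_zero': "\<phi> x = 0" if "x \<notin> cbox a b" for x
      using that \<phi>_zero[of x] box_subset_cbox[of a b] by blast
    have \<phi>_meas: "\<phi> \<in> borel_measurable borel" and \<psi>_meas: "\<psi> \<in> borel_measurable borel"
      by (intro borel_measurable_continuous_onI \<phi>_cont \<psi>_cont)+
    have line: "((\<lambda>t. \<phi> (x + t *\<^sub>R ?e)) has_real_derivative \<psi> (x + t *\<^sub>R ?e)) (at t)" for x t
    proof -
      have "((\<lambda>t. x + t *\<^sub>R ?e) has_derivative (\<lambda>r. r *\<^sub>R ?e)) (at t)"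
        by (auto intro!: derivative_eq_intros)
      from has_derivative_compose[OF this \<phi>_diff[unfolded frechet_derivative_works]]
      have D: "((\<lambda>t. \<phi> (x + t *\<^sub>R ?e)) has_derivative (\<lambda>r. frechet_derivative \<phi> (at (x + t *\<^sub>R ?e)) (r *\<^sub>R ?e))) (at t)" .
      have "linear (frechet_derivative \<phi> (at (x + t *\<^sub>R ?e)))"
        by (rule linear_frechet_derivative[OF \<phi>_diff])
      then have "frechet_derivative \<phi> (at (x + t *\<^sub>R ?e)) (r *\<^sub>R ?e) = \<psi> (x + t *\<^sub>R ?e) * r" for r
        by (simp add: linear_cmul \<psi>_def partial_def mult.commute)
      with D show ?thesis unfolding has_field_derivative_def by simp
    qed
    \<comment> \<open>The difference steps are at most 1, so the intermediate points of the mean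
      value theorem stay in the box whose upper corner is raised by 1 in every coordinate.\<close>
    have "bounded (\<psi> ` cbox a (b + 1))"
      by (rule compact_imp_bounded[OF compact_continuous_image[OF continuous_on_subset[OF \<psi>_cont subset_UNIV] compact_cbox]])
    then obtain B where B: "\<forall>y\<in>\<psi> ` cbox a (b + 1). norm y \<le> B"
      unfolding bounded_iff by (elim exE)
    let ?p = "\<lambda>n x. (\<phi> (x + ?h n *\<^sub>R ?e) - \<phi> x) / ?h n"
    have p_bound: "\<bar>?p n x\<bar> \<le> B" if x: "x \<in> cbox a b" for n x
    proof -
      have h: "0 < ?h n" "?h n \<le> 1" by simp_all
      obtain t where t: "0 < t" "t < ?h n"
        "\<phi> (x + ?h n *\<^sub>R ?e) - \<phi> (x + 0 *\<^sub>R ?e) = (?h n - 0) * \<psi> (x + t *\<^sub>R ?e)"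
        using MVT2[OF h(1), of "\<lambda>t. \<phi> (x + t *\<^sub>R ?e)" "\<lambda>t. \<psi> (x + t *\<^sub>R ?e)"] line by blast
      have "x + t *\<^sub>R ?e \<in> cbox a (b + 1)"
        unfolding mem_box_cart
      proof
        fix i
        have "a $ i \<le> x $ i" "x $ i \<le> b $ i" using x by (auto simp: mem_box_cart)
        then show "a $ i \<le> (x + t *\<^sub>R ?e) $ i \<and> (x + t *\<^sub>R ?e) $ i \<le> (b + 1) $ i"
          using t(1) less_le_trans[OF t(2) h(2)] by (auto simp: axis_def)
      qed
      then have "\<bar>\<psi> (x + t *\<^sub>R ?e)\<bar> \<le> B" using B by (simp add: ball_simps)
      moreover have "?p n x = \<psi> (x + t *\<^sub>R ?e)" using t(3) h(1) by (simp del: of_nat_Suc)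
      ultimately show ?thesis by simp
    qed
    have p_lim: "(\<lambda>n. ?p n x) \<longlonglongrightarrow> \<psi> x" for x
    proof -
      have "((\<lambda>t. (\<phi> (x + (0 + t) *\<^sub>R ?e) - \<phi> (x + 0 *\<^sub>R ?e)) / t) \<longlongrightarrow> \<psi> (x + 0 *\<^sub>R ?e)) (at 0)"
        using line[of x 0] unfolding DERIV_def .
      moreover have "filterlim ?h (at 0) sequentially"
        using LIMSEQ_Suc[OF lim_1_over_n] by (auto simp: filterlim_at simp del: of_nat_Suc)
      ultimately show ?thesis
        by (auto dest: filterlim_compose simp del: of_nat_Suc)
    qed
    \<comment> \<open>Translation turns the forward shift of the test function into a backward shift
      of v, which is why v carries left difference quotients.\<close>
    have parts: "(\<integral>x. v x * ?p n x \<partial>lborel) = - (\<integral>x. ?q n x * \<phi> x \<partial>lborel)" for n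
    proof -
      let ?c = "?h n *\<^sub>R ?e"
      have i1: "integrable lborel (\<lambda>x. v x * \<phi> (x + ?c))"
        by (rule integrable_continuous_support[of _ a b])
           (auto intro!: continuous_intros cont continuous_on_compose2[OF \<phi>_cont] simp: zero')
      have i2: "integrable lborel (\<lambda>x. v (x - ?c) * \<phi> x)"
        by (rule integrable_continuous_support[of _ a b])
           (auto intro!: continuous_intros \<phi>_cont continuous_on_compose2[OF cont] simp: \<phi>_zero')
      have i3: "integrable lborel (\<lambda>x. v x * \<phi> x)"
        by (rule integrable_continuous_support[of _ a b])
           (auto intro!: continuous_intros cont \<phi>_cont simp: zero')
      have "(\<integral>x. v x * \<phi> (x + ?c) \<partial>lborel) = (\<integral>x. v (x - ?c) * \<phi> x \<partial>lborel)"
        using lborel_integral_translation[OF borel_measurable_integrable[OF i2, simplified], of ?c]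
        by (simp add: add.commute)
      then have "(\<integral>x. v x * \<phi> (x + ?c) - v x * \<phi> x \<partial>lborel) = - (\<integral>x. v x * \<phi> x - v (x - ?c) * \<phi> x \<partial>lborel)"
        using i1 i2 i3 by simp
      then have "(\<integral>x. (v x * \<phi> (x + ?c) - v x * \<phi> x) / ?h n \<partial>lborel) =
          - (\<integral>x. (v x * \<phi> x - v (x - ?c) * \<phi> x) / ?h n \<partial>lborel)"
        by (simp only: integral_divide_zero minus_divide_left)
      then show ?thesis
        by (simp only: right_diff_distrib left_diff_distrib times_divide_eq_left times_divide_eq_right)
    qed
    have vI: "integrable lborel (\<lambda>x. \<bar>v x\<bar>)"
      by (rule integrable_continuous_support[of _ a b])
         (auto intro!: continuous_intros cont simp: zero')
    have \<phi>I: "integrable lborel (\<lambda>x. \<bar>\<phi> x\<bar>)"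
      by (rule integrable_continuous_support[of _ a b])
         (auto intro!: continuous_intros \<phi>_cont simp: \<phi>_zero')
    have L: "(\<lambda>n. \<integral>x. v x * ?p n x \<partial>lborel) \<longlonglongrightarrow> (\<integral>x. v x * \<psi> x \<partial>lborel)"
    proof (rule integral_dominated_convergence[where w = "\<lambda>x. B * \<bar>v x\<bar>"])
      show "AE x in lborel. norm (v x * ?p n x) \<le> B * \<bar>v x\<bar>" for n
      proof (rule AE_I2)
        fix x
        show "norm (v x * ?p n x) \<le> B * \<bar>v x\<bar>"
        \<comment> \<open>The bound on \<open>?p\<close> is available on the closed box only;
          elsewhere v vanishes.\<close>
        proof (cases "v x = 0")
          case False
          then have "x \<in> cbox a b" using zero box_subset_cbox by blast
          from mult_left_mono[OF p_bound[OF this, of n] abs_ge_zero[of "v x"]]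
          show ?thesis by (simp only: real_norm_def abs_mult mult.commute)
        qed simp
      qed
      show "(\<lambda>x. v x * ?p n x) \<in> borel_measurable lborel" for n
        using v_meas borel_measurable_continuous_onI[OF continuous_on_compose2[OF \<phi>_cont, of UNIV "\<lambda>x. x + ?h n *\<^sub>R ?e"]] \<phi>_meas
        by (auto intro!: continuous_intros)
      show "AE x in lborel. (\<lambda>n. v x * ?p n x) \<longlonglongrightarrow> v x * \<psi> x"
        by (intro AE_I2 tendsto_mult_left p_lim)
    qed (use vI v_meas \<psi>_meas in auto)
    have R: "(\<lambda>n. \<integral>x. ?q n x * \<phi> x \<partial>lborel) \<longlonglongrightarrow> (\<integral>x. g x * \<phi> x \<partial>lborel)"
    proof (rule integral_dominated_convergence[where w = "\<lambda>x. K * \<bar>\<phi> x\<bar>"])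
      show "AE x in lborel. norm (?q n x * \<phi> x) \<le> K * \<bar>\<phi> x\<bar>" for n
        unfolding real_norm_def abs_mult by (intro AE_I2 mult_right_mono q_bound) auto
      show "(\<lambda>x. ?q n x * \<phi> x) \<in> borel_measurable lborel" for n
        using borel_measurable_times[OF borel_measurable_continuous_onI[OF q_cont[of n]] \<phi>_meas] by simp
      show "AE x in lborel. (\<lambda>n. ?q n x * \<phi> x) \<longlonglongrightarrow> g x * \<phi> x"
        by (intro AE_I2 tendsto_mult_right lim)
    qed (use \<phi>I \<phi>_meas g_meas in auto)
    have "(\<integral>x. v x * \<psi> x \<partial>lborel) = - (\<integral>x. g x * \<phi> x \<partial>lborel)"
      using LIMSEQ_unique[OF L[unfolded parts] tendsto_minus[OF R]] .
    moreover have "l2_inner (box a b) v \<psi> = (\<integral>x. v x * \<psi> x \<partial>lborel)"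
      using v_meas \<psi>_meas by (intro l2_inner_lborel) (auto simp: zero)
    moreover have "l2_inner (box a b) g \<phi> = (\<integral>x. g x * \<phi> x \<partial>lborel)"
      using g_meas \<phi>_meas by (intro l2_inner_lborel) (auto simp: \<phi>_zero)
    ultimately show ?thesis by (simp add: \<psi>_def)
  qed
  ultimately show ?thesis
    unfolding has_weak_deriv_def by (auto simp: mset_single_iff)
qed

section \<open>One-dimensional hat functions\<close>

lemma
  assumes "0 < mesh_width a b N i"
  shows hat_nonneg: "0 \<le> hat a b N i k \<xi>" and hat_le_1: "hat a b N i k \<xi> \<le> 1"
    and hat_lipschitz: "\<bar>hat a b N i k \<xi> - hat a b N i k \<eta>\<bar> \<le> \<bar>\<xi> - \<eta>\<bar> / mesh_width a b N i"
proof -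
  let ?w = "mesh_width a b N i" and ?p = "a $ i + real k * mesh_width a b N i"
  show "0 \<le> hat a b N i k \<xi>" by (simp add: hat_def)
  show "hat a b N i k \<xi> \<le> 1" using assms by (simp add: hat_def)
  have "\<bar>max 0 (1 - r) - max 0 (1 - t)\<bar> \<le> \<bar>r - t\<bar>" for r t :: real by auto
  then have "\<bar>hat a b N i k \<xi> - hat a b N i k \<eta>\<bar> \<le> \<bar>\<bar>\<xi> - ?p\<bar> / ?w - \<bar>\<eta> - ?p\<bar> / ?w\<bar>"
    unfolding hat_def .
  also have "\<dots> = \<bar>\<bar>\<xi> - ?p\<bar> - \<bar>\<eta> - ?p\<bar>\<bar> / ?w"
    using assms by (simp add: diff_divide_distrib[symmetric])
  also have "\<dots> \<le> \<bar>\<xi> - \<eta>\<bar> / ?w"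
    using assms by (intro divide_right_mono) auto
  finally show "\<bar>hat a b N i k \<xi> - hat a b N i k \<eta>\<bar> \<le> \<bar>\<xi> - \<eta>\<bar> / ?w" .
qed

lemma continuous_on_hat: "continuous_on S (hat a b N i k)"
  unfolding hat_def[abs_def] divide_inverse by (intro continuous_intros)

text \<open>An interior node lies at least one mesh width away from both end points.\<close>

lemma hat_eq_0:
  assumes "0 < mesh_width a b N i" "1 \<le> k" "k < N i" "\<xi> \<le> a $ i \<or> b $ i \<le> \<xi>"
  shows "hat a b N i k \<xi> = 0"
proof -
  let ?w = "mesh_width a b N i"
  have "real (N i) * ?w = b $ i - a $ i"
    using assms(3) by (simp add: mesh_width_def)
  moreover have "1 * ?w \<le> real k * ?w" "(real k + 1) * ?w \<le> real (N i) * ?w"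
    using assms(1-3) by (intro mult_right_mono; simp)+
  ultimately have "?w \<le> \<bar>\<xi> - (a $ i + real k * ?w)\<bar>"
    using assms(4) by (auto simp: distrib_right)
  then show ?thesis using assms(1) by (simp add: hat_def)
qed

text \<open>To the left of any point, even of a kink, the hat function is affine on a short
  interval, so the backward quotient is eventually constant.\<close>

lemma hat_left_derivative:
  assumes w: "0 < mesh_width a b N i"
  obtains d where "(\<lambda>n. (hat a b N i k \<xi> - hat a b N i k (\<xi> - 1 / real (Suc n))) / (1 / real (Suc n))) \<longlonglongrightarrow> d"
proof -
  define w where "w = mesh_width a b N i"
  define p where "p = a $ i + real k * w"
  define H where "H \<xi> = max 0 (1 - \<bar>\<xi> - p\<bar> / w)" for \<xi>
  have "0 < w" using assms by (simp add: w_def)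
  have "\<exists>d. \<exists>\<epsilon>>0. \<forall>h. 0 < h \<and> h < \<epsilon> \<longrightarrow> H \<xi> - H (\<xi> - h) = d * h"
  proof -
    \<comment> \<open>Each piece includes its right end, so a kink takes the slope of the piece to
      its left. The \<epsilon> is then the distance to the left end of the piece, and arbitrary on
      the leftmost one.\<close>
    consider "\<xi> \<le> p - w" | "p - w < \<xi>" "\<xi> \<le> p" | "p < \<xi>" "\<xi> \<le> p + w" | "p + w < \<xi>" by linarith
    then show ?thesis
    proof cases
      case 1
      then have "H \<xi> - H (\<xi> - h) = 0 * h" if "0 < h \<and> h < 1" for h
        using that \<open>0 < w\<close> by (simp add: H_def)
      then show ?thesis by (intro exI[of _ 0] exI[of _ 1]) simp
    next
      case 2
      have "H \<xi> - H (\<xi> - h) = 1 / w * h" if "0 < h \<and> h < \<xi> - (p - w)" for h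
      proof -
        have "H \<eta> = 1 - (p - \<eta>) / w" if "p - w \<le> \<eta>" "\<eta> \<le> p" for \<eta>
          using that \<open>0 < w\<close> by (simp add: H_def)
        from this[of \<xi>] this[of "\<xi> - h"] show ?thesis using 2 that by (simp add: field_simps)
      qed
      with 2 show ?thesis by (intro exI[of _ "1 / w"] exI[of _ "\<xi> - (p - w)"]) simp
    next
      case 3
      have "H \<xi> - H (\<xi> - h) = - 1 / w * h" if "0 < h \<and> h < \<xi> - p" for h
      proof -
        have "H \<eta> = 1 - (\<eta> - p) / w" if "p \<le> \<eta>" "\<eta> \<le> p + w" for \<eta>
          using that \<open>0 < w\<close> by (simp add: H_def)
        from this[of \<xi>] this[of "\<xi> - h"] show ?thesis using 3 that by (simp add: field_simps)
      qed
      with 3 show ?thesis by (intro exI[of _ "- 1 / w"] exI[of _ "\<xi> - p"]) simp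
    next
      case 4
      have "H \<xi> - H (\<xi> - h) = 0 * h" if "0 < h \<and> h < \<xi> - (p + w)" for h
        using that 4 \<open>0 < w\<close> by (simp add: H_def)
      with 4 show ?thesis by (intro exI[of _ 0] exI[of _ "\<xi> - (p + w)"]) simp
    qed
  qed
  then obtain d \<epsilon> where "0 < \<epsilon>" and d: "\<And>h. 0 < h \<Longrightarrow> h < \<epsilon> \<Longrightarrow> H \<xi> - H (\<xi> - h) = d * h" by blast
  have "\<forall>\<^sub>F n in sequentially. 1 / real (Suc n) < \<epsilon>"
    using order_tendstoD(2)[OF LIMSEQ_Suc[OF lim_1_over_n] \<open>0 < \<epsilon>\<close>] .
  then have "\<forall>\<^sub>F n in sequentially. d = (H \<xi> - H (\<xi> - 1 / real (Suc n))) / (1 / real (Suc n))"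
    by eventually_elim (use d in \<open>simp del: of_nat_Suc\<close>)
  then have "(\<lambda>n. (H \<xi> - H (\<xi> - 1 / real (Suc n))) / (1 / real (Suc n))) \<longlonglongrightarrow> d"
    by (rule Lim_transform_eventually[OF tendsto_const])
  moreover have "hat a b N i k = H" by (simp add: hat_def H_def p_def w_def fun_eq_iff)
  ultimately show thesis by (intro that) simp
qed

section \<open>Tensor-product nodal functions and their span\<close>

definition nodal :: "real^'d \<Rightarrow> real^'d \<Rightarrow> ('d \<Rightarrow> nat) \<Rightarrow> ('d \<Rightarrow> nat) \<Rightarrow> real^'d \<Rightarrow> real" where
  "nodal a b N k x = (\<Prod>i\<in>UNIV. hat a b N i (k i) (x $ i))"

context
  fixes a b :: "real^'d" and N :: "'d \<Rightarrow> nat"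
  assumes w_pos: "\<And>i. 0 < mesh_width a b N i"
begin

lemma continuous_on_nodal: "continuous_on S (nodal a b N k)"
  unfolding nodal_def[abs_def]
  by (intro continuous_intros continuous_on_compose2[OF continuous_on_hat[of UNIV]]) auto

lemma nodal_eq_0:
  assumes "k \<in> inner_nodes N" "x \<notin> box a b"
  shows "nodal a b N k x = 0"
proof -
  obtain i where "x $ i \<le> a $ i \<or> b $ i \<le> x $ i"
    using assms(2) by (auto simp: mem_box_cart not_less)
  then have "hat a b N i (k i) (x $ i) = 0"
    using assms(1) by (intro hat_eq_0 w_pos) (auto simp: inner_nodes_def)
  then show ?thesis unfolding nodal_def by (intro prod_zero) auto
qed

text \<open>A shift along axis j changes only one factor. The difference quotient is that of a
  single hat function times a product in [0,1], so the Lipschitz constant and the left derivative of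
  the hat carry over.\<close>

lemma nodal_has_weak_deriv:
  assumes k: "k \<in> inner_nodes N"
  shows "\<exists>g. has_weak_deriv (box a b) {#j#} (nodal a b N k) g"
proof -
  have diff: "nodal a b N k x - nodal a b N k (x - h *\<^sub>R axis j 1) =
      (hat a b N j (k j) (x $ j) - hat a b N j (k j) (x $ j - h)) * (\<Prod>i\<in>UNIV - {j}. hat a b N i (k i) (x $ i))" for x h
  proof -
    have split: "nodal a b N k y = hat a b N j (k j) (y $ j) * (\<Prod>i\<in>UNIV - {j}. hat a b N i (k i) (y $ i))" for y
      unfolding nodal_def by (rule prod.remove) auto
    have "(\<Prod>i\<in>UNIV - {j}. hat a b N i (k i) ((x - h *\<^sub>R axis j 1) $ i)) = (\<Prod>i\<in>UNIV - {j}. hat a b N i (k i) (x $ i))"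
      by (intro prod.cong refl) (auto simp: axis_def)
    then show ?thesis unfolding split by (simp add: left_diff_distrib)
  qed
  let ?P = "\<lambda>x. \<Prod>i\<in>UNIV - {j}. hat a b N i (k i) (x $ i)"
  have P: "0 \<le> ?P x" "?P x \<le> 1" for x
    using hat_nonneg[OF w_pos] hat_le_1[OF w_pos] by (auto intro!: prod_nonneg prod_le_1)
  have "\<forall>\<xi>. \<exists>d. (\<lambda>n. (hat a b N j (k j) \<xi> - hat a b N j (k j) (\<xi> - 1 / real (Suc n))) / (1 / real (Suc n))) \<longlonglongrightarrow> d"
  proof
    fix \<xi>
    show "\<exists>d. (\<lambda>n. (hat a b N j (k j) \<xi> - hat a b N j (k j) (\<xi> - 1 / real (Suc n))) / (1 / real (Suc n))) \<longlonglongrightarrow> d"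
      by (rule hat_left_derivative[OF w_pos, of j "k j" \<xi>]) (rule exI)
  qed
  from choice[OF this] obtain dh where
    dh: "\<And>\<xi>. (\<lambda>n. (hat a b N j (k j) \<xi> - hat a b N j (k j) (\<xi> - 1 / real (Suc n))) / (1 / real (Suc n))) \<longlonglongrightarrow> dh \<xi>"
    by blast
  have "has_weak_deriv (box a b) {#j#} (nodal a b N k) (\<lambda>x. dh (x $ j) * ?P x)"
  proof (rule has_weak_deriv_difference_quotient[where K = "1 / mesh_width a b N j"])
    show "\<bar>nodal a b N k x - nodal a b N k (x - h *\<^sub>R axis j 1)\<bar> \<le> 1 / mesh_width a b N j * h" if "0 < h" for x h
    proof -
      have "\<bar>nodal a b N k x - nodal a b N k (x - h *\<^sub>R axis j 1)\<bar>
          = \<bar>hat a b N j (k j) (x $ j) - hat a b N j (k j) (x $ j - h)\<bar> * ?P x"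
        unfolding diff using P(1)[of x] by (simp add: abs_mult)
      also have "\<dots> \<le> \<bar>x $ j - (x $ j - h)\<bar> / mesh_width a b N j * 1"
        using P[of x] w_pos[of j] by (intro mult_mono hat_lipschitz) auto
      finally show ?thesis using that by simp
    qed
    show "(\<lambda>n. (nodal a b N k x - nodal a b N k (x - (1 / real (Suc n)) *\<^sub>R axis j 1)) / (1 / real (Suc n))) \<longlonglongrightarrow> dh (x $ j) * ?P x" for x
      unfolding diff times_divide_eq_left[symmetric] by (intro tendsto_mult_right dh)
  qed (use nodal_eq_0[OF k] continuous_on_nodal in auto)
  then show ?thesis by blast
qed

lemma finite_inner_nodes: "finite (inner_nodes N)"
proof (rule finite_subset)
  show "inner_nodes N \<subseteq> {k. \<forall>i. k i \<in> {..<N i}}" by (auto simp: inner_nodes_def)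
  show "finite {k. \<forall>i. k i \<in> {..<N i}}"
    using finite_PiE[of "UNIV :: 'd set" "\<lambda>i. {..<N i}"] by (simp add: PiE_def Pi_def)
qed

lemma Vh_eq: "Vh a b N = {v. \<exists>\<gamma>. v = (\<lambda>x. \<Sum>k\<in>inner_nodes N. \<gamma> k * nodal a b N k x)}"
  by (simp add: Vh_def nodal_def)

lemma Vh_continuous:
  assumes "v \<in> Vh a b N"
  shows "continuous_on UNIV v"
proof -
  obtain \<gamma> where "v = (\<lambda>x. \<Sum>k\<in>inner_nodes N. \<gamma> k * nodal a b N k x)"
    using assms by (auto simp: Vh_eq)
  then show ?thesis by (auto intro!: continuous_intros continuous_on_nodal)
qed

text \<open>The set where a continuous function is nonzero is open, and an open null set is empty.
  This upgrades equality almost everywhere to equality of functions, on which the uniqueness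
  demanded by \<open>THE\<close> in \<open>Ph\<close> and \<open>Lh\<close> rests.\<close>

lemma Vh_definite:
  assumes v: "v \<in> Vh a b N" "v \<in> L2 (box a b)" and 0: "l2_inner (box a b) v v = 0"
  shows "v = (\<lambda>x. 0)"
proof -
  obtain \<gamma> where \<gamma>: "v = (\<lambda>x. \<Sum>k\<in>inner_nodes N. \<gamma> k * nodal a b N k x)"
    using v(1) by (auto simp: Vh_eq)
  have out: "v x = 0" if "x \<notin> box a b" for x
    using nodal_eq_0 that by (simp add: \<gamma>)
  have "AE x in lebesgue_on (box a b). v x = 0"
    by (rule l2_inner_eq_0D[OF v(2) 0])
  then have "AE x in lebesgue. x \<in> box a b \<longrightarrow> v x = 0"
    by (subst (asm) AE_restrict_space_iff) auto
  then have "AE x in lebesgue. x \<notin> {x. v x \<noteq> 0}"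
    by eventually_elim (use out in auto)
  then have "{x. v x \<noteq> 0} \<in> null_sets lebesgue"
    by (simp add: completion.AE_iff_null_sets)
  then have "negligible {x. v x \<noteq> 0}"
    by (simp add: negligible_iff_null_sets)
  moreover have "open {x. v x \<noteq> 0}"
    by (rule open_Collect_neq[OF Vh_continuous[OF v(1)] continuous_on_const])
  ultimately have "{x. v x \<noteq> 0} = {}"
    using open_not_negligible by blast
  then show ?thesis by auto
qed

end

text \<open>Carried out for functions and not for classes modulo null sets: definiteness ensures
  that a residual other than the zero function has positive norm and can be normalised.\<close>

lemma Gram_Schmidt:
  fixes B :: "'k \<Rightarrow> real^'d \<Rightarrow> real"
  defines "sp \<equiv> \<lambda>K. {v. \<exists>\<gamma>. v = (\<lambda>x. \<Sum>k\<in>K. \<gamma> k * B k x)}"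
  assumes "finite K" and L2: "\<And>k. k \<in> K \<Longrightarrow> B k \<in> L2 \<Omega>"
    and definite: "\<And>v. v \<in> sp K \<Longrightarrow> l2_inner \<Omega> v v = 0 \<Longrightarrow> v = (\<lambda>x. 0)"
  shows "\<exists>(m::nat) e. (\<forall>j<m. e j \<in> sp K) \<and>
      (\<forall>i<m. \<forall>j<m. l2_inner \<Omega> (e i) (e j) = of_bool (i = j)) \<and>
      (\<forall>v\<in>sp K. \<exists>c. v = (\<lambda>x. \<Sum>j<m. c j * e j x))"
  using assms(2-)
proof (induction K rule: finite_induct)
  case empty
  show ?case by (intro exI[of _ "0::nat"]) (auto simp: sp_def)
next
  case (insert k K)
  have sp_I: "(\<lambda>x. \<Sum>l\<in>S. \<gamma> l * B l x) \<in> sp S" for \<gamma> S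
    unfolding sp_def mem_Collect_eq by (rule exI[of _ \<gamma>]) (rule refl)
  have sp_mono: "v \<in> sp (insert k K)" if v: "v \<in> sp K" for v
  proof -
    obtain \<gamma> where "v = (\<lambda>x. \<Sum>l\<in>K. \<gamma> l * B l x)" using v by (auto simp: sp_def)
    also have "\<dots> = (\<lambda>x. \<Sum>l\<in>insert k K. (\<gamma>(k := 0)) l * B l x)"
      using insert.hyps by (auto simp: fun_eq_iff intro!: sum.cong)
    finally show ?thesis by (simp only: sp_I)
  qed
  have sp_lin: "(\<lambda>x. r * v x + t * v' x) \<in> sp S" if v: "v \<in> sp S" "v' \<in> sp S" for v v' r t S
  proof -
    obtain \<gamma> \<gamma>' where "v = (\<lambda>x. \<Sum>l\<in>S. \<gamma> l * B l x)" "v' = (\<lambda>x. \<Sum>l\<in>S. \<gamma>' l * B l x)"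
      using v by (auto simp: sp_def)
    then have eq: "(\<lambda>x. r * v x + t * v' x) = (\<lambda>x. \<Sum>l\<in>S. (r * \<gamma> l + t * \<gamma>' l) * B l x)"
      by (simp add: sum_distrib_left sum.distrib algebra_simps)
    show ?thesis unfolding eq by (rule sp_I)
  qed
  have sp_sum: "(\<lambda>x. \<Sum>j<n. c j * e j x) \<in> sp S" if "\<forall>j<n. e j \<in> sp S" for n :: nat and c e S
    using that
  proof (induction n)
    case 0
    show ?case using sp_I[of "\<lambda>l. 0" S] by simp
  next
    case (Suc n)
    then show ?case using sp_lin[of "\<lambda>x. \<Sum>j<n. c j * e j x" S "e n" 1 "c n"] by simp
  qed
  have Bk: "B k \<in> sp (insert k K)"
  proof -
    have "(\<lambda>x. \<Sum>l\<in>insert k K. of_bool (l = k) * B l x) = B k"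
      using insert.hyps by (auto simp: fun_eq_iff intro!: sum.neutral)
    then show ?thesis using sp_I[of "\<lambda>l. of_bool (l = k)" "insert k K"] by simp
  qed
  have "\<exists>(m::nat) e. (\<forall>j<m. e j \<in> sp K) \<and>
      (\<forall>i<m. \<forall>j<m. l2_inner \<Omega> (e i) (e j) = of_bool (i = j)) \<and>
      (\<forall>v\<in>sp K. \<exists>c. v = (\<lambda>x. \<Sum>j<m. c j * e j x))"
    by (rule insert.IH) (simp_all add: insert.prems sp_mono)
  then obtain m :: nat and e where e: "\<forall>j<m. e j \<in> sp K"
    and on: "\<forall>i<m. \<forall>j<m. l2_inner \<Omega> (e i) (e j) = of_bool (i = j)"
    and span: "\<forall>v\<in>sp K. \<exists>c. v = (\<lambda>x. \<Sum>j<m. c j * e j x)"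
    by (elim exE conjE)
  have e_L2: "e j \<in> L2 \<Omega>" if j: "j < m" for j
  proof -
    obtain \<gamma> where "e j = (\<lambda>x. \<Sum>l\<in>K. \<gamma> l * B l x)" using e j by (auto simp: sp_def)
    then show ?thesis using insert.prems(1) by (auto intro: L2_sum)
  qed
  define \<beta> where "\<beta> j = l2_inner \<Omega> (B k) (e j)" for j
  define r where "r x = B k x - (\<Sum>j<m. \<beta> j * e j x)" for x
  have r_sp: "r \<in> sp (insert k K)"
    using sp_lin[OF Bk sp_sum[of m e, of _ \<beta>], of 1 "- 1"] sp_mono e by (simp add: r_def[abs_def])
  have S_L2: "(\<lambda>x. \<Sum>j<m. \<beta> j * e j x) \<in> L2 \<Omega>" using e_L2 by (intro L2_sum) auto
  have Bk_L2: "B k \<in> L2 \<Omega>" using insert.prems(1) by simp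
  have r_L2: "r \<in> L2 \<Omega>" unfolding r_def[abs_def] by (intro L2_diff Bk_L2 S_L2)
  have r_orth: "l2_inner \<Omega> r (e i) = 0" if i: "i < m" for i
  proof -
    have "l2_inner \<Omega> r (e i) = l2_inner \<Omega> (B k) (e i) - l2_inner \<Omega> (\<lambda>x. \<Sum>j<m. \<beta> j * e j x) (e i)"
      unfolding r_def[abs_def] by (rule l2_inner_diff_left[OF Bk_L2 S_L2 e_L2[OF i]])
    also have "l2_inner \<Omega> (\<lambda>x. \<Sum>j<m. \<beta> j * e j x) (e i) = (\<Sum>j<m. \<beta> j * l2_inner \<Omega> (e j) (e i))"
      using e_L2 i by (intro l2_inner_sum_left) auto
    also have "l2_inner \<Omega> (B k) (e i) = \<beta> i" by (simp add: \<beta>_def)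
    also have "(\<Sum>j<m. \<beta> j * l2_inner \<Omega> (e j) (e i)) = (\<Sum>j<m. if j = i then \<beta> j else 0)"
      using on i by (intro sum.cong refl) auto
    finally show ?thesis using i by simp
  qed
  have decomp: "\<exists>g c. v = (\<lambda>x. g * r x + (\<Sum>j<m. c j * e j x))" if v: "v \<in> sp (insert k K)" for v
  proof -
    obtain \<gamma> where \<gamma>: "v = (\<lambda>x. \<Sum>l\<in>insert k K. \<gamma> l * B l x)" using v by (auto simp: sp_def)
    obtain c where c: "(\<lambda>x. \<Sum>l\<in>K. \<gamma> l * B l x) = (\<lambda>x. \<Sum>j<m. c j * e j x)"
      using bspec[OF span sp_I[of \<gamma> K]] by (elim exE)
    have "v x = \<gamma> k * r x + (\<Sum>j<m. (\<gamma> k * \<beta> j + c j) * e j x)" for x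
      unfolding \<gamma> using insert.hyps fun_cong[OF c, of x]
      by (simp add: r_def algebra_simps sum.distrib sum_distrib_left)
    then show ?thesis by (intro exI[of _ "\<gamma> k"] exI[of _ "\<lambda>j. \<gamma> k * \<beta> j + c j"] ext)
  qed
  show ?case
  proof (cases "r = (\<lambda>x. 0)")
    case True
    have "\<forall>v\<in>sp (insert k K). \<exists>c. v = (\<lambda>x. \<Sum>j<m. c j * e j x)"
    proof
      fix v assume "v \<in> sp (insert k K)"
      from decomp[OF this] show "\<exists>c. v = (\<lambda>x. \<Sum>j<m. c j * e j x)" by (simp add: True)
    qed
    then show ?thesis using e on sp_mono by (intro exI[of _ m] exI[of _ e]) simp
  next
    case False
    let ?n = "l2_norm \<Omega> r"
    have rr: "l2_inner \<Omega> r r \<noteq> 0" using insert.prems(2)[OF r_sp] False by blast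
    then have n0: "?n \<noteq> 0" by (simp add: l2_norm_def)
    define e' where "e' = e(m := \<lambda>x. (1 / ?n) * r x)"
    have em: "e' m = (\<lambda>x. (1 / ?n) * r x)" and ej: "\<And>j. j < m \<Longrightarrow> e' j = e j"
      by (auto simp: e'_def)
    have "e' j \<in> sp (insert k K)" if "j < Suc m" for j
    proof (cases "j = m")
      case True
      then show ?thesis using sp_lin[OF r_sp r_sp, of "1 / ?n" 0] by (simp add: em)
    next
      case False
      then show ?thesis using that ej e sp_mono by auto
    qed
    moreover have "l2_inner \<Omega> (e' i) (e' j) = of_bool (i = j)" if ij: "i < Suc m" "j < Suc m" for i j
    proof -
      have "l2_inner \<Omega> (e' m) (e' m) = 1 / (?n * ?n) * l2_inner \<Omega> r r"
        unfolding em by (simp add: l2_inner_def)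
      also have "\<dots> = 1" using rr by (simp add: l2_norm_power2[symmetric] power2_eq_square)
      finally have 1: "l2_inner \<Omega> (e' m) (e' m) = 1" .
      have 2: "l2_inner \<Omega> (e' m) (e' j) = 0" "l2_inner \<Omega> (e' j) (e' m) = 0" if "j < m" for j
        using r_orth[OF that] l2_inner_commute[of \<Omega> "e' j" "e' m"] unfolding em ej[OF that] l2_inner_cmult_left by simp_all
      show ?thesis using ij 1 2 on ej by (auto simp: less_Suc_eq)
    qed
    moreover have "\<exists>c. v = (\<lambda>x. \<Sum>j<Suc m. c j * e' j x)" if v: "v \<in> sp (insert k K)" for v
    proof -
      obtain g c where "v = (\<lambda>x. g * r x + (\<Sum>j<m. c j * e j x))" using decomp[OF v] by (elim exE)
      then have "v = (\<lambda>x. \<Sum>j<Suc m. (c(m := g * ?n)) j * e' j x)"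
        using n0 by (simp add: em ej fun_eq_iff)
      then show ?thesis by (rule exI[where x = "c(m := g * ?n)"])
    qed
    ultimately show ?thesis by (intro exI[of _ "Suc m"] exI[of _ e']) simp
  qed
qed

section \<open>Galerkin coordinates\<close>

lemma l2_inner_cong_AE:
  assumes "v \<in> L2 \<Omega>" "v' \<in> L2 \<Omega>" "w \<in> L2 \<Omega>" "AE x in lebesgue_on \<Omega>. v x = v' x"
  shows "l2_inner \<Omega> v w = l2_inner \<Omega> v' w"
  unfolding l2_inner_def
  using assms(4) by (intro integral_cong_AE borel_measurable_integrable L2_mult_integrable assms) auto

lemma partials_test_function_L2:
  fixes a b :: "real^'d"
  assumes "\<phi> \<in> test_functions (box a b)"
  shows "partials is \<phi> \<in> L2 (box a b)"
proof -
  have cont: "continuous_on UNIV (partials is \<phi>)"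
    using assms by (auto simp: test_functions_def intro: differentiable_imp_continuous_on)
  have "bounded (partials is \<phi> ` cbox a b)"
    by (rule compact_imp_bounded[OF compact_continuous_image[OF continuous_on_subset[OF cont subset_UNIV] compact_cbox]])
  then obtain B where B: "\<forall>y\<in>partials is \<phi> ` cbox a b. norm y \<le> B"
    unfolding bounded_iff by (elim exE)
  show ?thesis
  proof (rule L2_bounded[OF continuous_imp_lebesgue_on_measurable[OF borel_measurable_continuous_onI[OF cont]]])
    show "\<bar>partials is \<phi> x\<bar> \<le> B" if "x \<in> box a b" for x
      using B that box_subset_cbox[of a b] by fastforce
  qed simp
qed

lemma has_weak_deriv_sum:
  fixes a b :: "real^'d"
  assumes "\<And>k. k \<in> K \<Longrightarrow> has_weak_deriv (box a b) \<alpha> (v k) (g k)"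
  shows "has_weak_deriv (box a b) \<alpha> (\<lambda>x. \<Sum>k\<in>K. \<gamma> k * v k x) (\<lambda>x. \<Sum>k\<in>K. \<gamma> k * g k x)"
proof -
  have L2: "v k \<in> L2 (box a b)" "g k \<in> L2 (box a b)" if "k \<in> K" for k
    using assms[OF that] by (simp_all add: has_weak_deriv_def)
  have "l2_inner (box a b) (\<lambda>x. \<Sum>k\<in>K. \<gamma> k * v k x) (partials is \<phi>)
      = (- 1) ^ size \<alpha> * l2_inner (box a b) (\<lambda>x. \<Sum>k\<in>K. \<gamma> k * g k x) \<phi>"
    if \<phi>: "\<phi> \<in> test_functions (box a b)" and "is": "mset is = \<alpha>" for \<phi> "is"
  proof -
    have "l2_inner (box a b) (v k) (partials is \<phi>) = (- 1) ^ size \<alpha> * l2_inner (box a b) (g k) \<phi>" if "k \<in> K" for k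
      using assms[OF that] \<phi> "is" unfolding has_weak_deriv_def by blast
    then have "(\<Sum>k\<in>K. \<gamma> k * l2_inner (box a b) (v k) (partials is \<phi>))
        = (- 1) ^ size \<alpha> * (\<Sum>k\<in>K. \<gamma> k * l2_inner (box a b) (g k) \<phi>)"
      by (simp add: sum_distrib_left mult.left_commute)
    moreover have "l2_inner (box a b) (\<lambda>x. \<Sum>k\<in>K. \<gamma> k * v k x) (partials is \<phi>)
        = (\<Sum>k\<in>K. \<gamma> k * l2_inner (box a b) (v k) (partials is \<phi>))"
      by (intro l2_inner_sum_left L2 partials_test_function_L2 \<phi>)
    moreover have "l2_inner (box a b) (\<lambda>x. \<Sum>k\<in>K. \<gamma> k * g k x) \<phi> = (\<Sum>k\<in>K. \<gamma> k * l2_inner (box a b) (g k) \<phi>)"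
      using test_function_L2[OF \<phi>] by (intro l2_inner_sum_left L2) auto
    ultimately show ?thesis by simp
  qed
  then show ?thesis unfolding has_weak_deriv_def by (auto intro: L2_sum L2)
qed

text \<open>Existence is what turns the value of \<open>SOME\<close> in \<open>weak_deriv\<close>
  into a genuine weak derivative, so that the energy form means what it should.\<close>

definition weakly_diff :: "(real^'d) set \<Rightarrow> (real^'d \<Rightarrow> real) \<Rightarrow> bool" where
  "weakly_diff \<Omega> v \<longleftrightarrow> (\<forall>i. \<exists>g. has_weak_deriv \<Omega> {#i#} v g)"

lemma weakly_diff_weak_deriv:
  "weakly_diff \<Omega> v \<Longrightarrow> has_weak_deriv \<Omega> {#i#} v (weak_deriv \<Omega> {#i#} v)"
  unfolding weakly_diff_def weak_deriv_def by (rule someI_ex[of "has_weak_deriv \<Omega> {#i#} v"]) (erule spec)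

lemma weakly_diff_L2: "weakly_diff \<Omega> v \<Longrightarrow> weak_deriv \<Omega> {#i#} v \<in> L2 \<Omega>"
  using weakly_diff_weak_deriv[of \<Omega> v i] by (simp add: has_weak_deriv_def)

lemma weakly_diff_sum:
  fixes a b :: "real^'d"
  assumes "\<And>k. k \<in> K \<Longrightarrow> weakly_diff (box a b) (v k)"
  shows "weakly_diff (box a b) (\<lambda>x. \<Sum>k\<in>K. \<gamma> k * v k x)"
  unfolding weakly_diff_def
  using has_weak_deriv_sum[OF weakly_diff_weak_deriv[OF assms]] by (intro allI exI)

lemma energy_form_eq:
  assumes "weakly_diff \<Omega> w" "weakly_diff \<Omega> v"
  shows "energy_form \<Omega> D w v = D * (\<Sum>i\<in>UNIV. l2_inner \<Omega> (weak_deriv \<Omega> {#i#} w) (weak_deriv \<Omega> {#i#} v))"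
  unfolding energy_form_def l2_inner_def
  using L2_mult_integrable[OF weakly_diff_L2[OF assms(1)] weakly_diff_L2[OF assms(2)]] by simp

lemma energy_form_commute: "energy_form \<Omega> D w v = energy_form \<Omega> D v w"
  by (simp add: energy_form_def mult.commute)

text \<open>The chosen derivative of a sum need not be the sum of the chosen derivatives as a
  function. By uniqueness the two agree almost everywhere, which is enough under the
  integral.\<close>

lemma energy_form_sum_left:
  fixes a b :: "real^'d"
  assumes v: "\<And>k. k \<in> K \<Longrightarrow> weakly_diff (box a b) (v k)" and w: "weakly_diff (box a b) w"
  shows "energy_form (box a b) D (\<lambda>x. \<Sum>k\<in>K. \<gamma> k * v k x) w = (\<Sum>k\<in>K. \<gamma> k * energy_form (box a b) D (v k) w)"
proof -
  let ?d = "\<lambda>i. weak_deriv (box a b) {#i#}"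
  have "l2_inner (box a b) (?d i (\<lambda>x. \<Sum>k\<in>K. \<gamma> k * v k x)) (?d i w)
      = (\<Sum>k\<in>K. \<gamma> k * l2_inner (box a b) (?d i (v k)) (?d i w))" for i
  proof -
    have hw: "has_weak_deriv (box a b) {#i#} (\<lambda>x. \<Sum>k\<in>K. \<gamma> k * v k x) (\<lambda>x. \<Sum>k\<in>K. \<gamma> k * ?d i (v k) x)"
      by (intro has_weak_deriv_sum weakly_diff_weak_deriv v)
    from v have dv: "?d i (v k) \<in> L2 (box a b)" if "k \<in> K" for k
      using that by (intro weakly_diff_L2)
    have "l2_inner (box a b) (?d i (\<lambda>x. \<Sum>k\<in>K. \<gamma> k * v k x)) (?d i w)
        = l2_inner (box a b) (\<lambda>x. \<Sum>k\<in>K. \<gamma> k * ?d i (v k) x) (?d i w)"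
      using hw by (intro l2_inner_cong_AE weak_deriv_eq[OF hw] weakly_diff_L2[OF w]) (simp add: has_weak_deriv_def)
    also have "\<dots> = (\<Sum>k\<in>K. \<gamma> k * l2_inner (box a b) (?d i (v k)) (?d i w))"
      by (intro l2_inner_sum_left dv weakly_diff_L2[OF w])
    finally show ?thesis .
  qed
  then have "energy_form (box a b) D (\<lambda>x. \<Sum>k\<in>K. \<gamma> k * v k x) w
      = D * (\<Sum>i\<in>UNIV. \<Sum>k\<in>K. \<gamma> k * l2_inner (box a b) (?d i (v k)) (?d i w))"
    by (simp add: energy_form_eq weakly_diff_sum v w)
  also have "\<dots> = (\<Sum>k\<in>K. \<gamma> k * (D * (\<Sum>i\<in>UNIV. l2_inner (box a b) (?d i (v k)) (?d i w))))"
    by (subst sum.swap) (simp add: sum_distrib_left mult.left_commute)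
  also have "\<dots> = (\<Sum>k\<in>K. \<gamma> k * energy_form (box a b) D (v k) w)"
    by (intro sum.cong refl) (simp add: energy_form_eq v w)
  finally show ?thesis .
qed

lemma energy_form_nonneg: "0 \<le> D \<Longrightarrow> 0 \<le> energy_form \<Omega> D w w"
  unfolding energy_form_def by (intro integral_nonneg_AE AE_I2 mult_nonneg_nonneg[of D] sum_nonneg zero_le_square)

lemma l2_norm_bounded:
  assumes "v \<in> L2 \<Omega>" "\<Omega> \<in> lmeasurable" "\<And>x. x \<in> \<Omega> \<Longrightarrow> \<bar>v x\<bar> \<le> B" "0 \<le> B"
  shows "l2_norm \<Omega> v \<le> B * sqrt (measure lebesgue \<Omega>)"
proof -
  interpret finite_measure "lebesgue_on \<Omega>" by (rule finite_measure_lebesgue_on[OF assms(2)])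
  have "l2_inner \<Omega> v v \<le> (\<integral>x. B\<^sup>2 \<partial>lebesgue_on \<Omega>)"
    unfolding l2_inner_def
  proof (rule integral_mono)
    show "v x * v x \<le> B\<^sup>2" if "x \<in> space (lebesgue_on \<Omega>)" for x
      using that assms(3)[of x] assms(4) by (simp add: power2_eq_square[symmetric] abs_le_square_iff[symmetric])
  qed (use L2_mult_integrable[OF assms(1,1)] in auto)
  also have "\<dots> = B\<^sup>2 * measure lebesgue \<Omega>"
    using assms(2) by (simp add: measure_restrict_space space_restrict_space)
  finally have "l2_norm \<Omega> v \<le> sqrt (B\<^sup>2 * measure lebesgue \<Omega>)"
    unfolding l2_norm_def by (rule real_sqrt_le_mono)
  then show ?thesis using assms(4) by (simp add: real_sqrt_mult)
qed

text \<open>An orthonormal basis for one mesh. As locale parameters, \<open>m\<close> and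
  \<open>e\<close> can be supplied once the mesh is known, and error bounds that do not mention them
  are uniform in the mesh.\<close>

locale galerkin =
  fixes a b :: "real^'d" and N :: "'d \<Rightarrow> nat" and D :: real
    and m :: nat and e :: "nat \<Rightarrow> real^'d \<Rightarrow> real"
  assumes mesh_pos: "\<And>i. 0 < mesh_width a b N i" and D_nonneg: "0 \<le> D"
    and basis: "\<And>j. j < m \<Longrightarrow> e j \<in> Vh a b N"
    and orthonormal: "\<And>i j. i < m \<Longrightarrow> j < m \<Longrightarrow> l2_inner (box a b) (e i) (e j) = of_bool (i = j)"
    and spanning: "\<And>v. v \<in> Vh a b N \<Longrightarrow> \<exists>c. v = (\<lambda>x. \<Sum>j<m. c j * e j x)"
begin

abbreviation "\<Omega> \<equiv> box a b"

definition comb :: "(nat \<Rightarrow> real) \<Rightarrow> real^'d \<Rightarrow> real" where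
  "comb c x = (\<Sum>j<m. c j * e j x)"

text \<open>Meant for all of L2: for a function outside the finite element space these are the
  coordinates of its projection.\<close>

definition coord :: "(real^'d \<Rightarrow> real) \<Rightarrow> nat \<Rightarrow> real" where
  "coord v j = l2_inner \<Omega> v (e j)"

text \<open>The row index belongs to the test function, so \<open>matvec\<close> yields the energy
  form tested with each basis function.\<close>

definition stiffness :: "nat \<Rightarrow> nat \<Rightarrow> real" where
  "stiffness i j = energy_form \<Omega> D (e j) (e i)"

lemma Vh_weakly_diff: "v \<in> Vh a b N \<Longrightarrow> weakly_diff \<Omega> v"
proof -
  assume "v \<in> Vh a b N"
  then obtain \<gamma> where "v = (\<lambda>x. \<Sum>k\<in>inner_nodes N. \<gamma> k * nodal a b N k x)"
    by (auto simp: Vh_eq[OF mesh_pos])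
  moreover have "weakly_diff \<Omega> (nodal a b N k)" if "k \<in> inner_nodes N" for k
    unfolding weakly_diff_def using nodal_has_weak_deriv[OF mesh_pos that] by blast
  ultimately show ?thesis by (simp add: weakly_diff_sum)
qed

lemma Vh_L2: "v \<in> Vh a b N \<Longrightarrow> v \<in> L2 \<Omega>"
  using weakly_diff_weak_deriv[OF Vh_weakly_diff] by (auto simp: has_weak_deriv_def)

lemma comb_cong: "(\<And>j. j < m \<Longrightarrow> c j = d j) \<Longrightarrow> comb c = comb d"
  by (simp add: comb_def fun_eq_iff)

lemma comb_lin: "comb (\<lambda>i. u i + r * v i) x = comb u x + r * comb v x"
  by (simp add: comb_def distrib_right sum.distrib sum_distrib_left mult.assoc)

lemma comb_Vh: "comb c \<in> Vh a b N"
proof -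
  have "\<exists>\<gamma>. \<forall>j<m. e j = (\<lambda>x. \<Sum>k\<in>inner_nodes N. \<gamma> j k * nodal a b N k x)"
  proof -
    have "\<forall>j. \<exists>\<gamma>. j < m \<longrightarrow> e j = (\<lambda>x. \<Sum>k\<in>inner_nodes N. \<gamma> k * nodal a b N k x)"
      using basis by (auto simp: Vh_eq[OF mesh_pos])
    from choice[OF this] show ?thesis .
  qed
  then obtain \<gamma> where \<gamma>: "\<And>j. j < m \<Longrightarrow> e j = (\<lambda>x. \<Sum>k\<in>inner_nodes N. \<gamma> j k * nodal a b N k x)" by auto
  have "comb c = (\<lambda>x. \<Sum>k\<in>inner_nodes N. (\<Sum>j<m. c j * \<gamma> j k) * nodal a b N k x)"
  proof
    fix x
    have "comb c x = (\<Sum>j<m. \<Sum>k\<in>inner_nodes N. c j * (\<gamma> j k * nodal a b N k x))"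
      unfolding comb_def by (intro sum.cong refl) (simp add: \<gamma> sum_distrib_left)
    then show "comb c x = (\<Sum>k\<in>inner_nodes N. (\<Sum>j<m. c j * \<gamma> j k) * nodal a b N k x)"
      by (subst (asm) sum.swap) (simp add: sum_distrib_right mult.assoc)
  qed
  then show ?thesis by (auto simp: Vh_eq[OF mesh_pos])
qed

lemma e_L2: "j < m \<Longrightarrow> e j \<in> L2 \<Omega>"
  by (intro Vh_L2 basis)

lemma comb_L2: "comb c \<in> L2 \<Omega>"
  by (intro Vh_L2 comb_Vh)

lemma inner_comb: "w \<in> L2 \<Omega> \<Longrightarrow> l2_inner \<Omega> (comb c) w = (\<Sum>j<m. c j * coord w j)"
  unfolding comb_def[abs_def] coord_def
  by (subst l2_inner_sum_left) (auto simp: e_L2 l2_inner_commute)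

lemma coord_comb: "i < m \<Longrightarrow> coord (comb c) i = c i"
proof -
  assume i: "i < m"
  have "coord (comb c) i = (\<Sum>j<m. c j * coord (e i) j)"
    unfolding coord_def[of "comb c"] by (rule inner_comb[OF e_L2[OF i]])
  also have "\<dots> = (\<Sum>j<m. if j = i then c j else 0)"
    using i by (intro sum.cong refl) (auto simp: coord_def orthonormal)
  finally show ?thesis using i by simp
qed

lemma comb_coord: "v \<in> Vh a b N \<Longrightarrow> comb (coord v) = v"
proof -
  assume "v \<in> Vh a b N"
  then obtain c where c: "v = comb c" using spanning unfolding comb_def[abs_def] by blast
  show ?thesis unfolding c by (rule comb_cong) (rule coord_comb)
qed

lemma Vh_eqI:
  assumes "v \<in> Vh a b N" "\<And>i. i < m \<Longrightarrow> coord v i = c i"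
  shows "v = comb c"
  using trans[OF comb_coord[OF assms(1), symmetric] comb_cong[OF assms(2)]] .

lemma norm_comb: "l2_norm \<Omega> (comb c) = L2_set c {..<m}"
  unfolding l2_norm_def L2_set_def inner_comb[OF comb_L2]
  by (simp add: coord_comb power2_eq_square)

lemma coord_diff:
  "v \<in> L2 \<Omega> \<Longrightarrow> w \<in> L2 \<Omega> \<Longrightarrow> j < m \<Longrightarrow> coord (\<lambda>x. v x - w x) j = coord v j - coord w j"
  unfolding coord_def by (intro l2_inner_diff_left e_L2)

lemma coord_sum:
  "(\<And>q. q \<in> Q \<Longrightarrow> v q \<in> L2 \<Omega>) \<Longrightarrow> j < m \<Longrightarrow>
    coord (\<lambda>x. \<Sum>q\<in>Q. \<gamma> q * v q x) j = (\<Sum>q\<in>Q. \<gamma> q * coord (v q) j)"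
  unfolding coord_def by (intro l2_inner_sum_left e_L2)

text \<open>Expand the squared norm of v minus its projection, which is nonnegative. Applied to the
  interpolation error of f, this passes to coordinates without a mesh-dependent constant.\<close>

lemma Bessel:
  assumes v: "v \<in> L2 \<Omega>"
  shows "L2_set (coord v) {..<m} \<le> l2_norm \<Omega> v"
proof -
  let ?p = "comb (coord v)"
  have pv: "l2_inner \<Omega> ?p v = (\<Sum>j<m. (coord v j)\<^sup>2)"
    by (simp add: inner_comb[OF v] power2_eq_square)
  have pp: "l2_inner \<Omega> ?p ?p = (\<Sum>j<m. (coord v j)\<^sup>2)"
    by (simp add: inner_comb[OF comb_L2] coord_comb power2_eq_square)
  have L: "(\<lambda>x. v x - ?p x) \<in> L2 \<Omega>" by (intro L2_diff v comb_L2)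
  have "0 \<le> l2_inner \<Omega> (\<lambda>x. v x - ?p x) (\<lambda>x. v x - ?p x)" by (rule l2_inner_nonneg)
  also have "\<dots> = l2_inner \<Omega> (\<lambda>x. v x - ?p x) v - l2_inner \<Omega> (\<lambda>x. v x - ?p x) ?p"
    unfolding l2_inner_diff_left[OF v comb_L2 L] by (simp only: l2_inner_commute)
  also have "\<dots> = l2_inner \<Omega> v v - (\<Sum>j<m. (coord v j)\<^sup>2)"
    unfolding l2_inner_diff_left[OF v comb_L2 v] l2_inner_diff_left[OF v comb_L2 comb_L2] pp pv
      l2_inner_commute[of \<Omega> v ?p] by simp
  finally have "(\<Sum>j<m. (coord v j)\<^sup>2) \<le> l2_inner \<Omega> v v" by simp
  then show ?thesis unfolding L2_set_def l2_norm_def by (rule real_sqrt_le_mono)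
qed

text \<open>\<open>THE\<close> asks for existence and uniqueness: orthonormality gives the first,
  testing with the basis functions the second.\<close>

lemma Ph_eq:
  assumes v: "v \<in> L2 \<Omega>"
  shows "Ph a b N v = comb (coord v)"
  unfolding Ph_def
proof (rule the_equality)
  have "l2_inner \<Omega> (\<lambda>x. v x - comb (coord v) x) w = 0" if w: "w \<in> Vh a b N" for w
    unfolding l2_inner_diff_left[OF v comb_L2 Vh_L2[OF w]]
    using inner_comb[OF v, of "coord w"] inner_comb[OF Vh_L2[OF w], of "coord v"]
    by (simp add: comb_coord[OF w] l2_inner_commute[of \<Omega> v] mult.commute)
  then show "comb (coord v) \<in> Vh a b N \<and> (\<forall>w\<in>Vh a b N. l2_inner \<Omega> (\<lambda>x. v x - comb (coord v) x) w = 0)"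
    using comb_Vh by blast
next
  fix g assume g: "g \<in> Vh a b N \<and> (\<forall>w\<in>Vh a b N. l2_inner \<Omega> (\<lambda>x. v x - g x) w = 0)"
  show "g = comb (coord v)"
  proof (rule Vh_eqI)
    fix i assume i: "i < m"
    have "coord (\<lambda>x. v x - g x) i = 0" unfolding coord_def using g basis[OF i] by blast
    then show "coord g i = coord v i" using coord_diff[OF v Vh_L2 i] g by simp
  qed (use g in blast)
qed

lemma energy_comb: "v \<in> Vh a b N \<Longrightarrow> energy_form \<Omega> D (comb c) v = (\<Sum>j<m. c j * energy_form \<Omega> D (e j) v)"
  unfolding comb_def[abs_def] by (intro energy_form_sum_left Vh_weakly_diff basis) auto

lemma energy_comb_basis: "i < m \<Longrightarrow> energy_form \<Omega> D (comb c) (e i) = matvec m stiffness c i"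
  by (simp add: energy_comb basis matvec_def stiffness_def mult.commute)

lemma energy_comb_comb: "energy_form \<Omega> D (comb c) (comb d) = (\<Sum>i<m. matvec m stiffness c i * d i)"
proof -
  have "energy_form \<Omega> D (comb c) (comb d) = (\<Sum>i<m. d i * energy_form \<Omega> D (e i) (comb c))"
    unfolding energy_form_commute[of _ _ "comb c"] by (rule energy_comb[OF comb_Vh])
  also have "\<dots> = (\<Sum>i<m. matvec m stiffness c i * d i)"
    by (intro sum.cong refl) (simp add: energy_form_commute[of _ _ _ "comb c"] energy_comb_basis mult.commute)
  finally show ?thesis .
qed

lemma stiffness_nonneg: "0 \<le> (\<Sum>i<m. matvec m stiffness c i * c i)"
  unfolding energy_comb_comb[symmetric] by (rule energy_form_nonneg[OF D_nonneg])

lemma Lh_comb: "Lh a b N D (comb c) = comb (matvec m stiffness c)"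
  unfolding Lh_def
proof (rule the_equality)
  have "l2_inner \<Omega> (comb (matvec m stiffness c)) v = energy_form \<Omega> D (comb c) v" if v: "v \<in> Vh a b N" for v
    using inner_comb[OF Vh_L2[OF v]] energy_comb_comb[of c "coord v"] by (simp add: comb_coord[OF v])
  then show "comb (matvec m stiffness c) \<in> Vh a b N \<and>
      (\<forall>v\<in>Vh a b N. l2_inner \<Omega> (comb (matvec m stiffness c)) v = energy_form \<Omega> D (comb c) v)"
    using comb_Vh by blast
next
  fix g assume g: "g \<in> Vh a b N \<and> (\<forall>v\<in>Vh a b N. l2_inner \<Omega> g v = energy_form \<Omega> D (comb c) v)"
  show "g = comb (matvec m stiffness c)"
  proof (rule Vh_eqI)
    fix i assume i: "i < m"
    show "coord g i = matvec m stiffness c i"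
      unfolding coord_def energy_comb_basis[OF i, symmetric] using g basis[OF i] by blast
  qed (use g in blast)
qed

text \<open>Operator powers act on coordinates as matrix powers, so the series at a point x is a
  combination of m convergent scalar series and may be interchanged with the sum over the
  basis.\<close>

lemma exp_Lh_comb: "exp_Lh a b N D r (comb c) = comb (propagator m stiffness r c)"
proof
  fix x
  let ?A = "\<lambda>w x. - r * Lh a b N D w x"
  have pow: "(?A ^^ k) (comb c) = comb (\<lambda>i. (- r) ^ k * (matvec m stiffness ^^ k) c i)" for k
  proof (induction k)
    case (Suc k)
    have "matvec m stiffness (\<lambda>i. q * v i) = (\<lambda>i. q * matvec m stiffness v i)" for q v
      by (simp add: matvec_def fun_eq_iff sum_distrib_left mult.left_commute)
    then show ?case using Suc
      by (simp add: Lh_comb) (simp add: comb_def sum_distrib_left mult.assoc sum_negf)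
  qed simp
  have "exp_Lh a b N D r (comb c) x = (\<Sum>k. \<Sum>j<m. (matvec m stiffness ^^ k) c j / fact k * (- r) ^ k * e j x)"
    unfolding exp_Lh_def op_exp_def pow by (simp add: comb_def sum_divide_distrib mult_ac)
  also have "\<dots> = (\<Sum>j<m. \<Sum>k. (matvec m stiffness ^^ k) c j / fact k * (- r) ^ k * e j x)"
    by (intro suminf_sum summable_mult2 propagator_summable) auto
  also have "\<dots> = comb (propagator m stiffness r c) x"
    unfolding comb_def propagator_def
    by (intro sum.cong refl suminf_mult2[symmetric] propagator_summable) auto
  finally show "exp_Lh a b N D r (comb c) x = comb (propagator m stiffness r c) x" .
qed

lemma eife_weight_comb:
  "eife_weight a b N D s c q r (comb g) =
    comb (\<lambda>j. integral {0..1} (\<lambda>\<theta>. propagator m stiffness (r * (1 - \<theta>)) g j * lagrange s c q \<theta>))"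
proof
  fix x
  have int: "(\<lambda>\<theta>. propagator m stiffness (r * (1 - \<theta>)) g j * lagrange s c q \<theta>) integrable_on {0..1}" if "j < m" for j
    using that
    by (intro integrable_continuous_interval continuous_on_mult continuous_on_lagrange
        continuous_on_compose2[OF continuous_on_propagator[of j m UNIV]] continuous_intros) auto
  have "eife_weight a b N D s c q r (comb g) x =
      integral {0..1} (\<lambda>\<theta>. \<Sum>j<m. (propagator m stiffness (r * (1 - \<theta>)) g j * lagrange s c q \<theta>) * e j x)"
    unfolding eife_weight_def exp_Lh_comb comb_def sum_distrib_right by (simp only: mult_ac)
  also have "\<dots> = (\<Sum>j<m. integral {0..1} (\<lambda>\<theta>. (propagator m stiffness (r * (1 - \<theta>)) g j * lagrange s c q \<theta>) * e j x))"
    by (rule integral_sum) (auto intro: integrable_on_mult_left int)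
  also have "\<dots> = comb (\<lambda>j. integral {0..1} (\<lambda>\<theta>. propagator m stiffness (r * (1 - \<theta>)) g j * lagrange s c q \<theta>)) x"
    unfolding comb_def by (simp only: integral_mult_left)
  finally show "eife_weight a b N D s c q r (comb g) x =
    comb (\<lambda>j. integral {0..1} (\<lambda>\<theta>. propagator m stiffness (r * (1 - \<theta>)) g j * lagrange s c q \<theta>)) x" .
qed

text \<open>Puts one step of the scheme into the form that
  \<open>exponential_quadrature_step\<close> expects of \<open>U'\<close>.\<close>

lemma eife_Suc_comb:
  fixes f :: "real \<Rightarrow> real^'d \<Rightarrow> real" and \<tau> :: "nat \<Rightarrow> real" and n :: nat
  defines "\<delta> \<equiv> \<tau> (Suc n) - \<tau> n"
  assumes U: "eife a b N D s c f u0 \<tau> n = comb U"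
    and f: "\<And>q. q \<in> {1..s} \<Longrightarrow> f (\<tau> n + c q * \<delta>) \<in> L2 \<Omega>"
  shows "eife a b N D s c f u0 \<tau> (Suc n) = comb (\<lambda>i. propagator m stiffness (\<delta>) U i +
      \<delta> * (\<Sum>q\<in>{1..s}. integral {0..1} (\<lambda>\<theta>.
        propagator m stiffness (\<delta> * (1 - \<theta>)) (coord (f (\<tau> n + c q * \<delta>))) i * lagrange s c q \<theta>)))"
proof
  fix x
  let ?I = "\<lambda>q i. integral {0..1} (\<lambda>\<theta>.
        propagator m stiffness (\<delta> * (1 - \<theta>)) (coord (f (\<tau> n + c q * \<delta>))) i * lagrange s c q \<theta>)"
  have "(\<Sum>q=1..s. eife_weight a b N D s c q (\<delta>) (Ph a b N (f (\<tau> n + c q * \<delta>))) x) = (\<Sum>q=1..s. comb (?I q) x)"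
    by (intro sum.cong refl) (simp add: Ph_eq f eife_weight_comb)
  also have "\<dots> = comb (\<lambda>i. \<Sum>q=1..s. ?I q i) x"
    unfolding comb_def sum_distrib_right by (rule sum.swap)
  finally show "eife a b N D s c f u0 \<tau> (Suc n) x = comb (\<lambda>i. propagator m stiffness (\<delta>) U i + \<delta> * (\<Sum>q\<in>{1..s}. ?I q i)) x"
    by (simp add: U exp_Lh_comb Let_def \<delta>_def[symmetric] comb_lin)
qed

text \<open>On the finite element space the L2 norm is the Euclidean norm of the coordinates, so the
  L2 limit defining the time derivative dominates the difference quotient of each single
  coordinate.\<close>

lemma semidiscrete_coord_deriv:
  assumes sol: "semidiscrete_solution a b N I D t0 f u0 uh" and t: "t \<in> I" and f: "f t \<in> L2 \<Omega>" and j: "j < m"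
  shows "((\<lambda>t. coord (uh t) j) has_real_derivative coord (f t) j - matvec m stiffness (coord (uh t)) j) (at t within I)"
proof -
  have uh: "uh r \<in> Vh a b N" if "r \<in> I" for r
    using sol that by (auto simp: semidiscrete_solution_def)
  obtain w where w: "w \<in> Vh a b N" "has_time_deriv \<Omega> I uh w t"
    "\<forall>x. w x + Lh a b N D (uh t) x = Ph a b N (f t) x"
    using sol t unfolding semidiscrete_solution_def by blast
  have "w = (\<lambda>x. comb (coord (f t)) x - comb (matvec m stiffness (coord (uh t))) x)"
    using w(3) Lh_comb[of "coord (uh t)"] by (auto simp: comb_coord[OF uh[OF t]] Ph_eq[OF f] fun_eq_iff eq_diff_eq)
  then have cw: "coord w i = coord (f t) i - matvec m stiffness (coord (uh t)) i" if "i < m" for i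
    using coord_diff[OF comb_L2 comb_L2 that] coord_comb[OF that] by simp
  have "((\<lambda>r. (coord (uh r) j - coord (uh t) j) / (r - t) - coord w j) \<longlongrightarrow> 0) (at t within I)"
  proof (rule Lim_null_comparison)
    show "((\<lambda>r. l2_norm \<Omega> (\<lambda>x. (uh r x - uh t x) / (r - t) - w x)) \<longlongrightarrow> 0) (at t within I)"
      using w(2) by (simp add: has_time_deriv_def)
    show "\<forall>\<^sub>F r in at t within I. norm ((coord (uh r) j - coord (uh t) j) / (r - t) - coord w j)
        \<le> l2_norm \<Omega> (\<lambda>x. (uh r x - uh t x) / (r - t) - w x)"
      unfolding eventually_at_filter
    proof (rule always_eventually, intro allI impI)
      fix r assume "r \<noteq> t" "r \<in> I"
      let ?c = "\<lambda>i. (coord (uh r) i - coord (uh t) i) / (r - t) - coord w i"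
      have "(\<lambda>x. (uh r x - uh t x) / (r - t) - w x) = comb ?c"
      proof
        fix x
        have "(uh r x - uh t x) / (r - t) - w x = (comb (coord (uh r)) x - comb (coord (uh t)) x) / (r - t) - comb (coord w) x"
          by (simp add: comb_coord uh \<open>r \<in> I\<close> t w(1))
        also have "\<dots> = comb ?c x"
          by (simp add: comb_def sum_subtractf sum_divide_distrib left_diff_distrib diff_divide_distrib)
        finally show "(uh r x - uh t x) / (r - t) - w x = comb ?c x" .
      qed
      then have "l2_norm \<Omega> (\<lambda>x. (uh r x - uh t x) / (r - t) - w x) = L2_set ?c {..<m}"
        by (simp only: norm_comb)
      moreover have "norm (?c j) \<le> L2_set (\<lambda>i. norm (?c i)) {..<m}"
        using j by (intro member_le_L2_set) auto
      ultimately show "norm (?c j) \<le> l2_norm \<Omega> (\<lambda>x. (uh r x - uh t x) / (r - t) - w x)"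
        by (simp add: L2_set_def)
    qed
  qed
  then have "((\<lambda>r. (coord (uh r) j - coord (uh t) j) / (r - t)) \<longlongrightarrow> coord w j) (at t within I)"
    by (rule LIM_zero_cancel)
  then show ?thesis unfolding cw[OF j] has_field_derivative_iff .
qed

end

section \<open>Error of the scheme\<close>

lemma galerkin_exists:
  assumes w: "\<And>i. 0 < mesh_width a b N i" and D: "0 \<le> D"
  shows "\<exists>m e. galerkin a b N D m e"
proof -
  have L2: "nodal a b N k \<in> L2 (box a b)" if "k \<in> inner_nodes N" for k
    using nodal_has_weak_deriv[OF w that] by (auto simp: has_weak_deriv_def)
  have Vh_L2: "v \<in> L2 (box a b)" if v: "v \<in> Vh a b N" for v
  proof -
    obtain \<gamma> where "v = (\<lambda>x. \<Sum>k\<in>inner_nodes N. \<gamma> k * nodal a b N k x)"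
      using v by (auto simp: Vh_eq[OF w])
    then show ?thesis using L2_sum[OF L2] by simp
  qed
  have "\<exists>(m::nat) e. (\<forall>j<m. e j \<in> Vh a b N) \<and>
      (\<forall>i<m. \<forall>j<m. l2_inner (box a b) (e i) (e j) = of_bool (i = j)) \<and>
      (\<forall>v\<in>Vh a b N. \<exists>c. v = (\<lambda>x. \<Sum>j<m. c j * e j x))"
    unfolding Vh_eq[OF w]
    by (rule Gram_Schmidt[OF finite_inner_nodes[OF w] L2])
       (auto simp: Vh_eq[OF w, symmetric] intro!: Vh_definite[OF w] Vh_L2)
  then obtain m :: nat and e where
    "\<forall>j<m. e j \<in> Vh a b N" "\<forall>i<m. \<forall>j<m. l2_inner (box a b) (e i) (e j) = of_bool (i = j)"
    "\<forall>v\<in>Vh a b N. \<exists>c. v = (\<lambda>x. \<Sum>j<m. c j * e j x)"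
    by (elim exE conjE)
  then have "galerkin a b N D m e"
    using w D by unfold_locales simp_all
  then show ?thesis by (intro exI)
qed

lemma time_partition_mono:
  assumes "time_partition t0 T NT \<tau>" "i \<le> j" "j \<le> NT"
  shows "\<tau> i \<le> \<tau> j"
  using assms(2,3)
proof (induction j rule: dec_induct)
  case (step n)
  then have "\<tau> n < \<tau> (Suc n)" using assms(1) by (simp add: time_partition_def)
  with step show ?case by simp
qed simp

lemma time_step_ge:
  assumes "n < NT"
  shows "\<tau> (Suc n) - \<tau> n \<le> time_step NT \<tau>"
  unfolding time_step_def using assms by (intro Max_ge) auto

text \<open>Contraction leaves the old error unamplified, so the contributions of the steps simply
  add. Measuring by elapsed time and not by the number of steps makes them telescope, also for
  nonuniform steps.\<close>

lemma (in galerkin) eife_error: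
  fixes f uh :: "real \<Rightarrow> real^'d \<Rightarrow> real" and df :: "nat \<Rightarrow> real \<Rightarrow> real^'d \<Rightarrow> real"
  assumes "s \<ge> 1" and c: "\<And>i. i \<in> {1..s} \<Longrightarrow> c i \<in> {0..1}" and inj: "inj_on c {1..s}"
    and u0: "u0 \<in> L2 \<Omega>" and f: "\<And>t. t \<in> {t0..t0 + T} \<Longrightarrow> f t \<in> L2 \<Omega>"
    and df_0: "df 0 = f"
    and df_Suc: "\<And>\<alpha> t x. \<alpha> < s \<Longrightarrow> t \<in> {t0..t0 + T} \<Longrightarrow> x \<in> \<Omega> \<Longrightarrow>
        ((\<lambda>r. df \<alpha> r x) has_real_derivative df (Suc \<alpha>) t x) (at t within {t0..t0 + T})"
    and M: "0 \<le> M" "\<And>t x. t \<in> {t0..t0 + T} \<Longrightarrow> x \<in> \<Omega> \<Longrightarrow> \<bar>df s t x\<bar> \<le> M"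
    and \<Lambda>: "0 \<le> \<Lambda>" "\<And>\<theta>. \<theta> \<in> {0..1} \<Longrightarrow> (\<Sum>i=1..s. \<bar>lagrange s c i \<theta>\<bar>) \<le> \<Lambda>"
    and part: "time_partition t0 T NT \<tau>"
    and sol: "semidiscrete_solution a b N {t0..t0 + T} D t0 f u0 uh"
    and n: "n \<le> NT"
  shows "l2_norm \<Omega> (\<lambda>x. uh (\<tau> n) x - eife a b N D s c f u0 \<tau> n x)
      \<le> (M * (1 + \<Lambda>) * sqrt (measure lebesgue \<Omega>)) * time_step NT \<tau> ^ s * (\<tau> n - t0)"
proof -
  \<comment> \<open>Bound on the s-th derivative, times one plus the Lebesgue constant from the
    interpolation error, times the root of the volume from estimating an L2 norm by a
    supremum.\<close>
  define C where "C = M * (1 + \<Lambda>) * sqrt (measure lebesgue \<Omega>)"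
  have "0 \<le> C" using M(1) \<Lambda>(1) by (simp add: C_def)
  have \<tau>0: "\<tau> 0 = t0" and \<tau>N: "\<tau> NT = t0 + T" using part by (simp_all add: time_partition_def)
  have \<tau>_in: "\<tau> k \<in> {t0..t0 + T}" if "k \<le> NT" for k
    using time_partition_mono[OF part _ that, of 0] time_partition_mono[OF part that] \<tau>0 \<tau>N by simp
  have uh: "uh t \<in> Vh a b N" if "t \<in> {t0..t0 + T}" for t
    using sol that by (auto simp: semidiscrete_solution_def)
  \<comment> \<open>The induction carries coordinates of the iterate along, since the operators of
    the scheme are evaluated on combinations of the basis. It starts with error zero, both solutions
    beginning at the same projection.\<close>
  have "\<exists>U. eife a b N D s c f u0 \<tau> n = comb U \<and>
      L2_set (\<lambda>i. coord (uh (\<tau> n)) i - U i) {..<m} \<le> C * time_step NT \<tau> ^ s * (\<tau> n - t0)"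
    using n
  proof (induction n)
    case 0
    have "eife a b N D s c f u0 \<tau> 0 = uh (\<tau> 0)"
      using sol by (simp add: semidiscrete_solution_def \<tau>0)
    also have "\<dots> = comb (coord (uh (\<tau> 0)))"
      by (rule comb_coord[symmetric, OF uh[OF \<tau>_in]]) simp
    finally show ?case
      by (intro exI[of _ "coord (uh (\<tau> 0))"]) (simp add: \<tau>0 L2_set_def)
  next
    case (Suc n)
    define \<delta> where "\<delta> = \<tau> (Suc n) - \<tau> n"
    have "n < NT" using Suc.prems by simp
    then have "0 < \<delta>" using part by (simp add: \<delta>_def time_partition_def)
    have \<tau>S: "\<tau> n + \<delta> = \<tau> (Suc n)" by (simp add: \<delta>_def)
    have sub: "{\<tau> n..\<tau> n + \<delta>} \<subseteq> {t0..t0 + T}"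
      unfolding \<tau>S using \<tau>_in[of n] \<tau>_in[OF Suc.prems] \<open>n < NT\<close> by auto
    have node: "\<tau> n + \<theta> * \<delta> \<in> {t0..t0 + T}" if "\<theta> \<in> {0..1}" for \<theta>
    proof (rule subsetD[OF sub])
      show "\<tau> n + \<theta> * \<delta> \<in> {\<tau> n..\<tau> n + \<delta>}"
        using that \<open>0 < \<delta>\<close> by (simp add: mult_left_le_one_le)
    qed
    obtain U where U: "eife a b N D s c f u0 \<tau> n = comb U"
      and err: "L2_set (\<lambda>i. coord (uh (\<tau> n)) i - U i) {..<m} \<le> C * time_step NT \<tau> ^ s * (\<tau> n - t0)"
      using Suc.IH \<open>n < NT\<close> by auto
    define U' where "U' i = propagator m stiffness \<delta> U i +
      \<delta> * (\<Sum>q\<in>{1..s}. integral {0..1} (\<lambda>\<theta>.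
        propagator m stiffness (\<delta> * (1 - \<theta>)) (coord (f (\<tau> n + c q * \<delta>))) i * lagrange s c q \<theta>))" for i
    have fq: "f (\<tau> n + c q * \<delta>) \<in> L2 \<Omega>" if "q \<in> {1..s}" for q
      by (intro f node c that)
    have eq: "eife a b N D s c f u0 \<tau> (Suc n) = comb U'"
      unfolding U'_def[abs_def] \<delta>_def by (rule eife_Suc_comb[OF U fq[unfolded \<delta>_def]])
    have "L2_set (\<lambda>i. coord (uh (\<tau> n + \<delta>)) i - U' i) {..<m}
        \<le> L2_set (\<lambda>i. coord (uh (\<tau> n)) i - U i) {..<m} + \<delta> * (C * \<delta> ^ s)"
    proof (rule exponential_quadrature_step[where M = stiffness and p = "\<lambda>t. coord (f t)"
          and F = "\<lambda>q. coord (f (\<tau> n + c q * \<delta>))" and l = "lagrange s c" and Q = "{1..s}"])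
      show "((\<lambda>t. coord (uh t) j) has_real_derivative coord (f t) j - matvec m stiffness (coord (uh t)) j)
          (at t within {\<tau> n..\<tau> n + \<delta>})" if "t \<in> {\<tau> n..\<tau> n + \<delta>}" "j < m" for t j
        using subsetD[OF sub that(1)]
        by (intro DERIV_subset[OF semidiscrete_coord_deriv[OF sol _ f that(2)] sub])
      fix \<theta> :: real assume \<theta>: "\<theta> \<in> {0..1}"
      \<comment> \<open>The interpolation error in time before projection, so that it can be bounded
        at each point x separately.\<close>
      let ?g = "\<lambda>x. f (\<tau> n + \<theta> * \<delta>) x - (\<Sum>q\<in>{1..s}. lagrange s c q \<theta> * f (\<tau> n + c q * \<delta>) x)"
      have S_L2: "(\<lambda>x. \<Sum>q\<in>{1..s}. lagrange s c q \<theta> * f (\<tau> n + c q * \<delta>) x) \<in> L2 \<Omega>"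
        by (intro L2_sum fq)
      have g_L2: "?g \<in> L2 \<Omega>" by (intro L2_diff f node \<theta> S_L2)
      have "L2_set (\<lambda>j. coord (f (\<tau> n + \<theta> * \<delta>)) j - (\<Sum>q\<in>{1..s}. lagrange s c q \<theta> * coord (f (\<tau> n + c q * \<delta>)) j)) {..<m}
          = L2_set (coord ?g) {..<m}"
        by (intro L2_set_cong refl)
           (simp only: lessThan_iff coord_diff[OF f[OF node[OF \<theta>]] S_L2] coord_sum[OF fq])
      also have "\<dots> \<le> l2_norm \<Omega> ?g" by (rule Bessel[OF g_L2])
      also have "\<dots> \<le> (M * \<delta> ^ s * (1 + \<Lambda>)) * sqrt (measure lebesgue \<Omega>)"
      proof (rule l2_norm_bounded[OF g_L2])
        fix x assume x: "x \<in> \<Omega>"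
        have "\<bar>df 0 (\<tau> n + \<theta> * \<delta>) x - (\<Sum>q=1..s. lagrange s c q \<theta> * df 0 (\<tau> n + c q * \<delta>) x)\<bar>
            \<le> M * \<delta> ^ s * (1 + (\<Sum>q=1..s. \<bar>lagrange s c q \<theta>\<bar>))"
        proof (rule lagrange_interpolation_error[where F = "\<lambda>\<alpha> t. df \<alpha> t x", OF \<open>s \<ge> 1\<close> less_imp_le[OF \<open>0 < \<delta>\<close>] inj c _ _ \<theta>])
          show "((\<lambda>t. df \<alpha> t x) has_real_derivative df (Suc \<alpha>) r x) (at r within {\<tau> n..\<tau> n + \<delta>})"
            if "\<alpha> < s" "r \<in> {\<tau> n..\<tau> n + \<delta>}" for \<alpha> r
            by (rule DERIV_subset[OF df_Suc[OF that(1) subsetD[OF sub that(2)] x] sub])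
          show "\<bar>df s r x\<bar> \<le> M" if "r \<in> {\<tau> n..\<tau> n + \<delta>}" for r
            by (rule M(2)[OF subsetD[OF sub that] x])
        qed
        also have "\<dots> \<le> M * \<delta> ^ s * (1 + \<Lambda>)"
          using \<Lambda>(2)[OF \<theta>] M(1) \<open>0 < \<delta>\<close> by (intro mult_left_mono) auto
        finally show "\<bar>?g x\<bar> \<le> M * \<delta> ^ s * (1 + \<Lambda>)" by (simp add: df_0)
      qed (use M(1) \<Lambda>(1) \<open>0 < \<delta>\<close> in auto)
      also have "\<dots> = C * \<delta> ^ s" by (simp add: C_def mult_ac)
      finally show "L2_set (\<lambda>j. coord (f (\<tau> n + \<theta> * \<delta>)) j - (\<Sum>q\<in>{1..s}. lagrange s c q \<theta> * coord (f (\<tau> n + c q * \<delta>)) j)) {..<m}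
          \<le> C * \<delta> ^ s" .
    qed (auto simp: stiffness_nonneg \<open>0 < \<delta>\<close> continuous_on_lagrange U'_def)
    \<comment> \<open>Only s factors are enlarged to the maximal step; the remaining \<delta> is
      kept, being the increment of the elapsed time.\<close>
    also have "\<dots> \<le> C * time_step NT \<tau> ^ s * (\<tau> n - t0) + \<delta> * (C * time_step NT \<tau> ^ s)"
      using time_step_ge[OF \<open>n < NT\<close>, of \<tau>] \<open>0 < \<delta>\<close> \<open>0 \<le> C\<close>
      by (intro add_mono err mult_left_mono power_mono) (auto simp: \<delta>_def)
    also have "\<dots> = C * time_step NT \<tau> ^ s * (\<tau> (Suc n) - t0)"
      by (simp add: \<delta>_def algebra_simps)
    finally show ?case unfolding \<tau>S eq by blast
  qed
  then obtain U where U: "eife a b N D s c f u0 \<tau> n = comb U"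
    and err: "L2_set (\<lambda>i. coord (uh (\<tau> n)) i - U i) {..<m} \<le> C * time_step NT \<tau> ^ s * (\<tau> n - t0)" by blast
  have "uh (\<tau> n) x - comb U x = comb (\<lambda>i. coord (uh (\<tau> n)) i - U i) x" for x
  proof -
    have "uh (\<tau> n) x = comb (coord (uh (\<tau> n))) x" by (simp only: comb_coord[OF uh[OF \<tau>_in[OF n]]])
    then show ?thesis by (simp add: comb_def left_diff_distrib sum_subtractf)
  qed
  then have "l2_norm \<Omega> (\<lambda>x. uh (\<tau> n) x - eife a b N D s c f u0 \<tau> n x) = L2_set (\<lambda>i. coord (uh (\<tau> n)) i - U i) {..<m}"
    unfolding U norm_comb[symmetric] by simp
  with err show ?thesis by (simp add: C_def)
qed

theorem theorem3p1:
  fixes a b :: "real^'d"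
    and D t0 T \<kappa> :: real
    and s :: nat
    and c :: "nat \<Rightarrow> real"
    and u0 :: "real^'d \<Rightarrow> real"
    and f u ut :: "real \<Rightarrow> real^'d \<Rightarrow> real"
    and df :: "nat \<Rightarrow> real \<Rightarrow> real^'d \<Rightarrow> real"
  assumes domain: "\<And>i. a $ i < b $ i"
    and "D > 0" and "T > 0"
    and "s \<ge> 1"
    and nodes: "\<And>i. i \<in> {1..s} \<Longrightarrow> c i \<in> {0..1}" "inj_on c {1..s}"
    and initial: "u0 \<in> sobolev 2 (box a b) \<inter> sobolev_0_1 (box a b)"
    and df_0: "df 0 = f"
    and df_Suc: "\<And>\<alpha> t x. \<alpha> < s \<Longrightarrow> t \<in> {t0..t0 + T} \<Longrightarrow> x \<in> box a b \<Longrightarrow>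
        ((\<lambda>r. df \<alpha> r x) has_real_derivative df (Suc \<alpha>) t x) (at t within {t0..t0 + T})"
    and df_bounded: "\<exists>M. \<forall>t\<in>{t0..t0 + T}. \<forall>x\<in>box a b. (\<Sum>\<alpha>\<le>s. \<bar>df \<alpha> t x\<bar>) \<le> M"
    and solution: "parabolic_solution (box a b) {t0..t0 + T} D t0 f u0 u ut"
    and u_bounded: "\<exists>M. \<forall>t\<in>{t0..t0 + T}. sobolev_norm 2 (box a b) (u t) \<le> M"
    and ut_H2: "\<And>t. t \<in> {t0..t0 + T} \<Longrightarrow> ut t \<in> sobolev 2 (box a b)"
    and ut_bounded: "\<exists>M. \<forall>t\<in>{t0..t0 + T}. sobolev_norm 2 (box a b) (ut t) \<le> M"
  shows "\<exists>C>0. \<forall>N NT \<tau> uh.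
      (\<forall>i. N i \<ge> 1) \<and> quasi_uniform \<kappa> a b N \<and>
      time_partition t0 T NT \<tau> \<and>
      semidiscrete_solution a b N {t0..t0 + T} D t0 f u0 uh \<longrightarrow>
      (\<forall>n\<le>NT. l2_norm (box a b) (\<lambda>x. uh (\<tau> n) x - eife a b N D s c f u0 \<tau> n x)
                 \<le> C * time_step NT \<tau> ^ s)"
proof -
  have u0: "u0 \<in> L2 (box a b)" using initial by (auto simp: sobolev_def)
  have f: "f t \<in> L2 (box a b)" if "t \<in> {t0..t0 + T}" for t
    using solution that by (auto simp: parabolic_solution_def)
  obtain M' where M': "\<forall>t\<in>{t0..t0 + T}. \<forall>x\<in>box a b. (\<Sum>\<alpha>\<le>s. \<bar>df \<alpha> t x\<bar>) \<le> M'"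
    using df_bounded by blast
  have M: "\<bar>df s t x\<bar> \<le> \<bar>M'\<bar>" if "t \<in> {t0..t0 + T}" "x \<in> box a b" for t x
  proof -
    have "\<bar>df s t x\<bar> \<le> (\<Sum>\<alpha>\<le>s. \<bar>df \<alpha> t x\<bar>)"
      by (rule member_le_sum[where f = "\<lambda>\<alpha>. \<bar>df \<alpha> t x\<bar>"]) auto
    also have "\<dots> \<le> M'" using M' that by blast
    finally show ?thesis by simp
  qed
  obtain \<Lambda> where \<Lambda>: "0 \<le> \<Lambda>" "\<And>\<theta>. \<theta> \<in> {0..1} \<Longrightarrow> (\<Sum>i=1..s. \<bar>lagrange s c i \<theta>\<bar>) \<le> \<Lambda>"
    using lagrange_bounded[of s c] by metis
  \<comment> \<open>Built from f, the nodes and the domain alone, all fixed before the mesh, the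
    partition and the semi-discrete solution.\<close>
  define C0 where "C0 = \<bar>M'\<bar> * (1 + \<Lambda>) * sqrt (measure lebesgue (box a b))"
  have "0 \<le> C0" using \<Lambda>(1) by (simp add: C0_def)
  \<comment> \<open>The elapsed time is at most T; adding 1 makes the constant positive even when
    \<open>C0\<close> is zero.\<close>
  have bound: "l2_norm (box a b) (\<lambda>x. uh (\<tau> n) x - eife a b N D s c f u0 \<tau> n x) \<le> (C0 * T + 1) * time_step NT \<tau> ^ s"
    if N: "\<forall>i. N i \<ge> 1" and part: "time_partition t0 T NT \<tau>"
      and sol: "semidiscrete_solution a b N {t0..t0 + T} D t0 f u0 uh" and n: "n \<le> NT" for N NT \<tau> uh n
  proof -
    have w: "0 < mesh_width a b N i" for i
      using domain[of i] N[rule_format, of i] by (simp add: mesh_width_def)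
    obtain m e where "galerkin a b N D m e"
      using galerkin_exists[OF w less_imp_le[OF \<open>D > 0\<close>]] by (elim exE)
    then interpret galerkin a b N D m e .
    have "l2_norm (box a b) (\<lambda>x. uh (\<tau> n) x - eife a b N D s c f u0 \<tau> n x) \<le> C0 * time_step NT \<tau> ^ s * (\<tau> n - t0)"
      unfolding C0_def
      by (rule eife_error[OF \<open>s \<ge> 1\<close> nodes u0 f df_0 df_Suc abs_ge_zero M \<Lambda> part sol n])
    also have "\<dots> \<le> C0 * time_step NT \<tau> ^ s * T + 1 * time_step NT \<tau> ^ s"
    proof -
      have "\<tau> n \<le> t0 + T"
        using time_partition_mono[OF part n order.refl] part by (simp add: time_partition_def)
      \<comment> \<open>Without any step T would be 0; hence \<open>time_step\<close> is the maximum
        of a nonempty set.\<close>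
      moreover have "NT \<noteq> 0" using part \<open>T > 0\<close> unfolding time_partition_def by (intro notI) simp
      then have "0 \<le> time_step NT \<tau>"
        using time_step_ge[of 0 NT \<tau>] time_partition_mono[OF part, of 0 1] by simp
      ultimately show ?thesis
        using \<open>0 \<le> C0\<close> by (intro add_increasing2 mult_left_mono) auto
    qed
    finally show ?thesis by (simp add: algebra_simps)
  qed
  have "0 < C0 * T + 1" using \<open>0 \<le> C0\<close> \<open>T > 0\<close> by (intro add_nonneg_pos mult_nonneg_nonneg) auto
  with bound show ?thesis by (intro exI[of _ "C0 * T + 1"]) blast
qed

end
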